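(* Neither the symmetrized bidisc $G$ nor the tetrablock $E$ contains a point of symmetry.
   Context: $\mathbb{D}$ is the open unit disc. The symmetrized bidisc is $G=\{(z+w,zw):z,w\in\mathbb{D}\}\subset\mathbb{C}^2$. The tetrablock is the domain $E$ of points $(x^1,x^2,x^3)\in\mathbb{C}^3$ (superscripts denote components) such that $1-x^1z-x^2w+x^3zw\neq0$ for all $z,w\in\mathbb{C}$ with $|z|\le1$ and $|w|\le1$. A point $\lambda$ in a domain $\Omega$ is a point of symmetry of $\Omega$ if there exists a holomorphic self-map $\gamma$ of $\Omega$ such that $\gamma\circ\gamma=\mathrm{id}_\Omega$ and $\lambda$ is an isolated fixed point of $\gamma$. *)

theory Defs
  imports "HOL-Analysis.Analysis"
begin

text \<open>Holomorphy in several complex variables: the (real) Frechet derivative at every point is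
  complex linear, that is, given by a complex Jacobian matrix.  As with the one-variable
  \<open>holomorphic_on\<close> of the library, this is meant for open \<open>S\<close>.\<close>

definition holomorphic_map_on :: "(complex^'n \<Rightarrow> complex^'m) \<Rightarrow> (complex^'n) set \<Rightarrow> bool"
  where "holomorphic_map_on f S \<longleftrightarrow>
    (\<forall>x\<in>S. \<exists>J :: complex^'n^'m. (f has_derivative (\<lambda>h. J *v h)) (at x within S))"

definition point_of_symmetry :: "(complex^'n) set \<Rightarrow> complex^'n \<Rightarrow> bool"
  where "point_of_symmetry \<Omega> l \<longleftrightarrow>
    (\<exists>\<gamma>. holomorphic_map_on \<gamma> \<Omega> \<and> \<gamma> ` \<Omega> \<subseteq> \<Omega> \<and> (\<forall>x\<in>\<Omega>. \<gamma> (\<gamma> x) = x) \<and>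
         l isolated_in {x\<in>\<Omega>. \<gamma> x = x})"

definition symmetrized_bidisc :: "(complex^2) set"
  where "symmetrized_bidisc = {vector [z + w, z * w] | z w. z \<in> ball 0 1 \<and> w \<in> ball 0 1}"

definition tetrablock :: "(complex^3) set"
  where "tetrablock =
    {x. \<forall>z w. norm z \<le> 1 \<and> norm w \<le> 1 \<longrightarrow> 1 - x$1 * z - x$2 * w + x$3 * z * w \<noteq> 0}"

end

theory Submission
  imports Defs "HOL-Complex_Analysis.Riemann_Mapping"
begin

text \<open>
  Let \<open>\<gamma>\<close> be a symmetry of one of the two domains at \<open>l\<close>. Linearization shows that its derivative at \<open>l\<close> is
  \<open>- 1\<close> (\<open>jacobian_at_isolated_fixed_point\<close>). Explicit automorphisms move \<open>l\<close> to a point \<open>(0, 0, a)\<close> of the flat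
  disc in the tetrablock, or \<open>(0, a)\<close> in the symmetrized bidisc. The two cases run in parallel because the
  symmetrized bidisc is the slice of the tetrablock with equal first two coordinates, via
  \<open>(s, p) \<mapsto> (s/2, s/2, p)\<close>. The infinitesimal geometry along the flat disc is rigid enough to exclude \<open>\<gamma>\<close>.

  The tetrablock has a circle of functions into the unit disc (\<open>tetra_Psi\<close>), all of which restrict to
  rotations of the flat disc. By the equality case of the Schwarz lemma \<open>\<gamma>\<close> therefore preserves
  the flat disc and acts on it as the Moebius involution \<open>m\<close> about \<open>a\<close> (\<open>flat_disc_rigidity\<close>). Now consider
  directions transverse to the flat disc. Discs obtained by symmetrizing two disc automorphisms bound the size
  of transverse vectors over \<open>q\<close> from above, and Schwarz-Pick for the circle of functions bounds the size
  of their images over \<open>m q\<close> from below. The result is that the transverse Jacobian determinant of \<open>\<gamma>\<close> over \<open>q\<close> has modulus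
  at most \<open>(c q)\<^sup>2\<close> with \<open>c q = (1 - norm (m q)) / (1 - norm q)\<close>; in the symmetrized bidisc the square of the
  transverse derivative takes the place of the determinant. Since \<open>\<gamma>\<close> is an involution, the determinants over
  \<open>q\<close> and \<open>m q\<close> are reciprocal, and so are \<open>c q\<close> and \<open>c (m q)\<close>. Hence there is equality for every \<open>q\<close>.

  In the equality case all bounds are attained by some transverse vector, with image \<open>(y1, y2)\<close>. Tilting the
  test discs slightly towards the flat direction then gives a first-order condition: over \<open>q \<noteq> 0\<close> it forces
  \<open>m q \<noteq> 0\<close> and makes \<open>(m' q)\<^sup>2 q / (m q y1 y2)\<close> a positive real number (\<open>disc_transport_extremal\<close>). Geometrically,
  the unit sphere of transverse vectors over \<open>q\<close> is built from an ellipse whose axes turn with \<open>q\<close> and which is a circle only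
  over \<open>0\<close>. If \<open>a \<noteq> 0\<close>, then \<open>q = m 0\<close> contradicts this, as \<open>m q = 0\<close>. If \<open>a = 0\<close>, then \<open>m q = - q\<close>, so \<open>y1 y2\<close>
  is negative for all \<open>q \<noteq> 0\<close>; but \<open>y1 y2\<close> tends to \<open>1\<close> as \<open>q \<rightarrow> 0\<close>, because the derivative at \<open>l\<close> is
  \<open>- 1\<close>.
\<close>

section \<open>Holomorphic maps and their Jacobians\<close>

lemma holomorphic_map_on_open:
  assumes "open S"
  shows "holomorphic_map_on f S \<longleftrightarrow> (\<exists>J. \<forall>x\<in>S. (f has_derivative (\<lambda>h. J x *v h)) (at x))"
  unfolding holomorphic_map_on_def
  using at_within_open[OF _ assms] by (metis (no_types, lifting))

lemma has_derivative_componentwiseI: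
  fixes f :: "'a::real_normed_vector \<Rightarrow> complex^'n"
  assumes "\<And>i. ((\<lambda>x. f x $ i) has_derivative (\<lambda>h. f' h $ i)) (at x within S)"
  shows "(f has_derivative f') (at x within S)"
proof (subst has_derivative_componentwise_within, rule ballI)
  fix b :: "complex^'n" assume "b \<in> Basis"
  then obtain i c where b: "b = axis i c" unfolding Basis_vec_def by blast
  have "((\<lambda>x. f x $ i \<bullet> c) has_derivative (\<lambda>h. f' h $ i \<bullet> c)) (at x within S)"
    using assms by (rule has_derivative_inner_left)
  then show "((\<lambda>x. f x \<bullet> b) has_derivative (\<lambda>h. f' h \<bullet> b)) (at x within S)"
    by (simp add: b inner_axis)
qed

lemma has_field_derivative_component_comp:
  fixes f :: "complex^'n \<Rightarrow> complex^'m" and d :: "complex \<Rightarrow> complex^'n"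
  assumes f: "(f has_derivative (\<lambda>h. J *v h)) (at (d t))"
    and d: "\<And>j. ((\<lambda>t. d t $ j) has_field_derivative v $ j) (at t)"
  shows "((\<lambda>t. f (d t) $ i) has_field_derivative (J *v v) $ i) (at t)"
proof -
  have "(d has_derivative (\<lambda>h. h *s v)) (at t)"
    using d unfolding has_field_derivative_def
    by (intro has_derivative_componentwiseI) (simp add: mult.commute mult_commute_abs)
  then have "((\<lambda>t. f (d t)) has_derivative (\<lambda>h. J *v (h *s v))) (at t)"
    using has_derivative_compose[of d "\<lambda>h. h *s v" t UNIV f, OF _ f] by blast
  then have "((\<lambda>t. f (d t) $ i) has_derivative (\<lambda>h. (J *v (h *s v)) $ i)) (at t)"
    by (rule bounded_linear.has_derivative[OF bounded_linear_vec_nth])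
  moreover have "(J *v (h *s v)) $ i = (J *v v) $ i * h" for h
    by (simp add: matrix_vector_mult_def sum_distrib_left sum_distrib_right mult_ac)
  ultimately show ?thesis by (simp add: has_field_derivative_def)
qed

text \<open>A real Frechet derivative that is complex linear at every point is automatically continuous: each
  Jacobian entry is a one-variable derivative at \<open>0\<close>, and Cauchy's inequality bounds the difference of two
  such derivatives by the supremum of the difference of the functions, which is small by uniform
  continuity.\<close>

lemma continuous_on_jacobian:
  fixes f :: "complex^'n \<Rightarrow> complex^'m"
  assumes "open S" and f: "\<And>x. x \<in> S \<Longrightarrow> (f has_derivative (\<lambda>h. J x *v h)) (at x)"
  shows "continuous_on S J"
proof -
  have "continuous_on S (\<lambda>x. J x $ i $ j)" for i j
  proof (rule continuous_onI)
    fix a :: "complex^'n" and e :: real assume a: "a \<in> S" and e: "e > 0"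
    obtain R where R: "R > 0" and RS: "cball a R \<subseteq> S"
      using \<open>open S\<close> a unfolding open_contains_cball by blast
    define r where "r = R / 2"
    have r: "r > 0" using R by (simp add: r_def)
    have "continuous_on S f"
      using f by (intro continuous_at_imp_continuous_on) (blast intro: has_derivative_continuous)
    then have "uniformly_continuous_on (cball a R) f"
      by (intro compact_uniformly_continuous compact_cball continuous_on_subset[OF _ RS])
    moreover have "e/2 * r > 0" using e r by simp
    ultimately obtain d where d: "d > 0" and
      unif: "\<And>x y. \<lbrakk>x \<in> cball a R; y \<in> cball a R; dist y x < d\<rbrakk> \<Longrightarrow> dist (f y) (f x) < e/2 * r"
      unfolding uniformly_continuous_on_def by blast
    have "dist (J x $ i $ j) (J a $ i $ j) \<le> e" if x: "dist x a < min d r" for x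
    proof -
      have nt: "norm (t *s axis j (1::complex)) = norm t" for t
      proof -
        have "t *s axis j 1 = axis j t" by (simp add: vec_eq_iff axis_def)
        moreover have "(\<Sum>i\<in>UNIV. (norm ((axis j t :: complex^'n) $ i))\<^sup>2) = (\<Sum>i\<in>UNIV. if i = j then (norm t)\<^sup>2 else 0)"
          by (intro sum.cong) (auto simp: axis_def)
        ultimately show ?thesis by (simp add: norm_vec_def L2_set_def)
      qed
      have inb: "y + t *s axis j 1 \<in> cball a R" if "norm t \<le> r" "y = x \<or> y = a" for t y
      proof -
        have "dist a (y + t *s axis j 1) \<le> dist a y + norm (t *s axis j (1::complex))"
          by (metis dist_norm dist_triangle dist_commute add_diff_cancel_left')
        then show ?thesis using that x R nt[of t] by (auto simp: r_def dist_commute)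
      qed
      have der: "((\<lambda>t. f (y + t *s axis j 1) $ i) has_field_derivative J (y + t *s axis j 1) $ i $ j) (at t)"
        if "norm t \<le> r" "y = x \<or> y = a" for t y
      proof -
        have "((\<lambda>t. f (y + t *s axis j 1) $ i) has_field_derivative (J (y + t *s axis j 1) *v axis j 1) $ i) (at t)"
          by (rule has_field_derivative_component_comp) (use inb[OF that] RS f in \<open>auto intro!: derivative_eq_intros simp: axis_def\<close>)
        moreover have "(M *v axis j 1) $ i = M $ i $ j" for M :: "complex^'n^'m"
          by (simp add: matrix_vector_mult_def axis_def if_distrib[of "\<lambda>x. _ * x"] cong: if_cong)
        ultimately show ?thesis by simp
      qed
      \<comment> \<open>the difference of the slices through \<open>x\<close> and \<open>a\<close> in direction \<open>j\<close>\<close>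
      define g where "g t = f (x + t *s axis j 1) $ i - f (a + t *s axis j 1) $ i" for t
      have dg: "(g has_field_derivative J (x + t *s axis j 1) $ i $ j - J (a + t *s axis j 1) $ i $ j) (at t)"
        if "norm t \<le> r" for t
        unfolding g_def by (intro DERIV_diff der that) auto
      have "norm ((deriv ^^ 1) g 0) \<le> fact 1 * (e/2 * r) / r ^ 1"
      proof (rule Cauchy_inequality)
        show "g holomorphic_on ball 0 r"
          using dg by (auto intro!: holomorphic_onI simp: field_differentiable_def intro: has_field_derivative_at_within)
            (metis has_field_derivative_at_within order_less_imp_le)
        show "continuous_on (cball 0 r) g"
          by (intro continuous_at_imp_continuous_on ballI DERIV_isCont[OF dg]) auto
        show "norm (g t) \<le> e/2 * r" if "norm (0 - t) = r" for t
        proof -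
          have "dist (f (x + t *s axis j 1)) (f (a + t *s axis j 1)) < e/2 * r"
            using that x by (intro unif inb) auto
          moreover have "norm (g t) \<le> norm (f (x + t *s axis j 1) - f (a + t *s axis j 1))"
            unfolding g_def by (metis component_le_norm_cart vector_minus_component Finite_Cartesian_Product.norm_nth_le)
          ultimately show ?thesis by (simp add: dist_norm)
        qed
      qed (use r in auto)
      moreover have "deriv g 0 = J x $ i $ j - J a $ i $ j"
        using DERIV_imp_deriv[OF dg[of 0]] r by simp
      ultimately show ?thesis using r e by (simp add: dist_norm)
    qed
    then show "\<exists>d>0. \<forall>x\<in>S. dist x a < d \<longrightarrow> dist (J x $ i $ j) (J a $ i $ j) \<le> e"
      using d r by (metis min_less_iff_conj)
  qed
  then have "continuous_on S (\<lambda>x. \<chi> i j. J x $ i $ j)"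
    by (intro continuous_on_vec_lambda)
  then show ?thesis by simp
qed

lemma holomorphic_on_component_comp:
  fixes f :: "complex^'n \<Rightarrow> complex^'m" and d :: "complex \<Rightarrow> complex^'n"
  assumes f: "\<And>x. x \<in> S \<Longrightarrow> (f has_derivative (\<lambda>h. J x *v h)) (at x)"
    and d: "\<And>j. (\<lambda>t. d t $ j) holomorphic_on U" and "open U" and mem: "\<And>t. t \<in> U \<Longrightarrow> d t \<in> S"
  shows "(\<lambda>t. f (d t) $ i) holomorphic_on U"
  unfolding holomorphic_on_open[OF \<open>open U\<close>]
proof
  fix t assume t: "t \<in> U"
  have "((\<lambda>t. d t $ j) has_field_derivative (\<chi> j. deriv (\<lambda>t. d t $ j) t) $ j) (at t)" for j
    using holomorphic_derivI[OF d \<open>open U\<close> t] by simp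
  from has_field_derivative_component_comp[OF f[OF mem[OF t]] this]
  show "\<exists>f'. ((\<lambda>t. f (d t) $ i) has_field_derivative f') (at t)" by blast
qed

text \<open>The scalar-valued version of the condition in \<open>holomorphic_map_on\<close>, with homogeneity in place of an
  explicit row of coefficients. It is stable under field operations, which makes rational maps easy to
  recognize as holomorphic.\<close>

definition complex_linear_derivative_at :: "(complex^'n \<Rightarrow> complex) \<Rightarrow> complex^'n \<Rightarrow> bool" where
  "complex_linear_derivative_at f x \<longleftrightarrow>
    (\<exists>f'. (f has_derivative f') (at x) \<and> (\<forall>c h. f' (c *s h) = c * f' h))"

lemma complex_linear_derivative_at_const: "complex_linear_derivative_at (\<lambda>x. c) x"
  unfolding complex_linear_derivative_at_def by (intro exI[of _ "\<lambda>h. 0"]) simp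

lemma complex_linear_derivative_at_nth: "complex_linear_derivative_at (\<lambda>x. x $ i) x"
  unfolding complex_linear_derivative_at_def
  by (intro exI[of _ "\<lambda>h. h $ i"]) (simp add: bounded_linear_imp_has_derivative bounded_linear_vec_nth)

lemma complex_linear_derivative_at_add:
  assumes "complex_linear_derivative_at f x" "complex_linear_derivative_at g x"
  shows "complex_linear_derivative_at (\<lambda>x. f x + g x) x"
proof -
  obtain f' g' where D: "(f has_derivative f') (at x)" "(g has_derivative g') (at x)"
    and s: "\<And>c h. f' (c *s h) = c * f' h" "\<And>c h. g' (c *s h) = c * g' h"
    using assms unfolding complex_linear_derivative_at_def by blast
  show ?thesis
    unfolding complex_linear_derivative_at_def
    by (rule exI, rule conjI, rule has_derivative_add[OF D]) (simp add: s distrib_left)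
qed

lemma complex_linear_derivative_at_mult:
  assumes "complex_linear_derivative_at f x" "complex_linear_derivative_at g x"
  shows "complex_linear_derivative_at (\<lambda>x. f x * g x) x"
proof -
  obtain f' g' where D: "(f has_derivative f') (at x)" "(g has_derivative g') (at x)"
    and s: "\<And>c h. f' (c *s h) = c * f' h" "\<And>c h. g' (c *s h) = c * g' h"
    using assms unfolding complex_linear_derivative_at_def by blast
  show ?thesis
    unfolding complex_linear_derivative_at_def by (rule exI, rule conjI, rule has_derivative_mult[OF D]) (simp add: s algebra_simps)
qed

lemma complex_linear_derivative_at_diff:
  assumes "complex_linear_derivative_at f x" "complex_linear_derivative_at g x"
  shows "complex_linear_derivative_at (\<lambda>x. f x - g x) x"
  using complex_linear_derivative_at_add[OF assms(1)
      complex_linear_derivative_at_mult[OF complex_linear_derivative_at_const[of "-1"] assms(2)]] by simp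

lemma complex_linear_derivative_at_divide:
  assumes "complex_linear_derivative_at f x" "complex_linear_derivative_at g x" "g x \<noteq> 0"
  shows "complex_linear_derivative_at (\<lambda>x. f x / g x) x"
proof -
  obtain f' g' where D: "(f has_derivative f') (at x)" "(g has_derivative g') (at x)"
    and s: "\<And>c h. f' (c *s h) = c * f' h" "\<And>c h. g' (c *s h) = c * g' h"
    using assms unfolding complex_linear_derivative_at_def by blast
  show ?thesis
    unfolding complex_linear_derivative_at_def
    by (rule exI, rule conjI, rule has_derivative_divide[OF D assms(3)]) (simp add: s algebra_simps divide_inverse)
qed

lemmas complex_linear_derivative_at_intros =
  complex_linear_derivative_at_const complex_linear_derivative_at_nth complex_linear_derivative_at_add
  complex_linear_derivative_at_diff complex_linear_derivative_at_mult complex_linear_derivative_at_divide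

lemma holomorphic_map_onI:
  fixes f :: "complex^'n \<Rightarrow> complex^'m"
  assumes "\<And>x i. x \<in> S \<Longrightarrow> complex_linear_derivative_at (\<lambda>x. f x $ i) x"
  shows "holomorphic_map_on f S"
  unfolding holomorphic_map_on_def
proof
  fix x assume "x \<in> S"
  then have "\<forall>i. \<exists>f'. ((\<lambda>x. f x $ i) has_derivative f') (at x) \<and> (\<forall>c h. f' (c *s h) = c * f' h)"
    using assms unfolding complex_linear_derivative_at_def by blast
  from choice[OF this] obtain g where
    g: "\<And>i. ((\<lambda>x. f x $ i) has_derivative g i) (at x)" "\<And>i c h. g i (c *s h) = c * g i h"
    by blast
  define f' where "f' h = (\<chi> i. g i h)" for h
  have "(f has_derivative f') (at x)"
    by (rule has_derivative_componentwiseI) (simp add: f'_def g)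
  then have D: "(f has_derivative f') (at x within S)" by (rule has_derivative_at_withinI)
  have "f' (u + v) = f' u + f' v" for u v
    using linear_add[OF has_derivative_linear[OF D]] .
  moreover have "f' (c *s h) = c *s f' h" for c h by (simp add: f'_def g vec_eq_iff)
  ultimately have lin: "Vector_Spaces.linear (*s) (*s) f'"
    by (simp add: Vector_Spaces.linear_iff vec.vector_space_axioms)
  have "(f has_derivative (\<lambda>h. matrix f' *v h)) (at x within S)"
    by (rule has_derivative_eq_rhs[OF D]) (simp add: fun_eq_iff matrix_works[OF lin])
  then show "\<exists>J. (f has_derivative (\<lambda>h. J *v h)) (at x within S)" by blast
qed

lemma norm_matrix_vector_mult_le:
  fixes M :: "complex^'n^'m"
  shows "norm (M *v v) \<le> (\<Sum>i\<in>UNIV. \<Sum>j\<in>UNIV. norm (M $ i $ j)) * norm v"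
proof -
  have "norm (M *v v) \<le> (\<Sum>i\<in>UNIV. norm ((M *v v) $ i))"
    by (simp add: norm_vec_def L2_set_le_sum)
  also have "\<dots> \<le> (\<Sum>i\<in>UNIV. \<Sum>j\<in>UNIV. norm (M $ i $ j) * norm v)"
  proof (rule sum_mono)
    fix i
    have "norm ((M *v v) $ i) \<le> (\<Sum>j\<in>UNIV. norm (M $ i $ j * v $ j))"
      by (simp add: matrix_vector_mult_def norm_sum)
    also have "\<dots> \<le> (\<Sum>j\<in>UNIV. norm (M $ i $ j) * norm v)"
      by (intro sum_mono) (simp add: norm_mult mult_left_mono Finite_Cartesian_Product.norm_nth_le)
    finally show "norm ((M *v v) $ i) \<le> \<dots>" .
  qed
  finally show ?thesis by (simp add: sum_distrib_right)
qed

lemma involution_jacobian: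
  fixes \<gamma> :: "complex^'n \<Rightarrow> complex^'n"
  assumes "open S" and f: "\<And>x. x \<in> S \<Longrightarrow> (\<gamma> has_derivative (\<lambda>h. J x *v h)) (at x)"
    and S: "\<gamma> ` S \<subseteq> S" and inv: "\<And>x. x \<in> S \<Longrightarrow> \<gamma> (\<gamma> x) = x" and x: "x \<in> S"
  shows "J (\<gamma> x) *v (J x *v h) = h"
proof -
  have "((\<lambda>x. \<gamma> (\<gamma> x)) has_derivative (\<lambda>h. J (\<gamma> x) *v (J x *v h))) (at x)"
    using has_derivative_compose[OF f[OF x] f[of "\<gamma> x"]] S x by blast
  moreover have "((\<lambda>x. \<gamma> (\<gamma> x)) has_derivative (\<lambda>h. h)) (at x)"
    by (rule has_derivative_transform_within_open[OF has_derivative_ident \<open>open S\<close> x]) (simp add: inv)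
  ultimately show ?thesis using has_derivative_unique by metis
qed

text \<open>Linearization of an involution. The averaged map \<open>H x = (x - l) + A (\<gamma> x - l)\<close>, where \<open>A\<close> is the
  Jacobian at \<open>l\<close>, satisfies \<open>H \<circ> \<gamma> = A H\<close> and has derivative \<open>2\<close> at \<open>l\<close>. It is thus a local chart in
  which \<open>\<gamma>\<close> is linear, and a fixed vector of \<open>A\<close> would give fixed points of \<open>\<gamma>\<close> arbitrarily close to \<open>l\<close>.
  Since \<open>A\<close> is an involution without fixed vectors, it is \<open>- 1\<close>.\<close>

lemma jacobian_at_isolated_fixed_point:
  fixes \<gamma> :: "complex^'n \<Rightarrow> complex^'n"
  assumes "open S" and f: "\<And>x. x \<in> S \<Longrightarrow> (\<gamma> has_derivative (\<lambda>h. J x *v h)) (at x)"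
    and S: "\<gamma> ` S \<subseteq> S" and inv: "\<And>x. x \<in> S \<Longrightarrow> \<gamma> (\<gamma> x) = x"
    and l: "l isolated_in {x\<in>S. \<gamma> x = x}"
  shows "J l *v h = - h"
proof (rule ccontr)
  assume ne: "J l *v h \<noteq> - h"
  have lS: "l \<in> S" and fixl: "\<gamma> l = l" using l by (auto simp: isolated_in_def)
  define A where "A = J l"
  have AA: "A *v (A *v v) = v" for v
    using involution_jacobian[OF assms(1-4) lS] by (simp add: fixl A_def)
  define v where "v = h + A *v h"
  have Av: "A *v v = v" by (simp add: v_def matrix_vector_right_distrib AA add.commute)
  have v0: "v \<noteq> 0" using ne by (auto simp: v_def A_def add_eq_0_iff)
  define H where "H x = (x - l) + A *v (\<gamma> x - l)" for x
  define H' where "H' x h = h + A *v (J x *v h)" for x h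
  have bl: "bounded_linear ((*v) M)" for M :: "complex^'n^'n"
    by (simp add: matrix_vector_mul_bounded_linear)
  have dH: "(H has_derivative H' x) (at x)" if "x \<in> S" for x
    unfolding H_def H'_def
    by (auto intro!: derivative_eq_intros f that bounded_linear.has_derivative[OF bl])
  have H'l: "H' l h = 2 *\<^sub>R h" for h
    by (simp add: H'_def AA flip: A_def scaleR_2)
  have contJ: "continuous_on S J" by (rule continuous_on_jacobian[OF \<open>open S\<close> f])
  define M where "M x = (\<Sum>i\<in>UNIV. \<Sum>j\<in>UNIV. norm ((A ** (J x - J l)) $ i $ j))" for x
  have Mb: "onorm (\<lambda>v. H' x v - H' l v) \<le> M x" for x
  proof (rule onorm_le)
    fix v
    have "H' x v - H' l v = (A ** (J x - J l)) *v v"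
      by (simp add: H'_def matrix_vector_mul_assoc[symmetric] matrix_vector_mult_diff_rdistrib
          matrix_vector_mult_diff_distrib)
    then show "norm (H' x v - H' l v) \<le> M x * norm v"
      using norm_matrix_vector_mult_le by (simp add: M_def)
  qed
  have contM: "continuous_on S M"
    unfolding M_def matrix_matrix_mult_def
    by (auto intro!: continuous_intros contJ)
  obtain r where r: "r > 0" "ball l r \<subseteq> S" "inj_on H (ball l r)"
  proof (rule has_derivative_locally_injective[OF lS \<open>open S\<close>, where f = H and f' = H'])
    show "bounded_linear (\<lambda>x::complex^'n. (1/2) *\<^sub>R x)" by (rule bounded_linear_scaleR_right)
    show "(\<lambda>x. (1/2) *\<^sub>R x) \<circ> H' l = id" by (auto simp: H'l)
    fix e :: real assume "e > 0"
    then obtain d where "d > 0" and d: "\<And>x. x \<in> S \<Longrightarrow> dist x l < d \<Longrightarrow> dist (M x) (M l) < e"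
      using contM lS unfolding continuous_on_iff by metis
    obtain d' where "d' > 0" and d': "ball l d' \<subseteq> S" using \<open>open S\<close> lS openE by blast
    have "onorm (\<lambda>v. H' x v - H' l v) < e" if "dist l x < min d d'" for x
    proof -
      have "M l = 0" by (simp add: M_def)
      moreover have "x \<in> S" using d' that by auto
      ultimately show ?thesis using d[of x] Mb[of x] that by (auto simp: dist_commute)
    qed
    then show "\<exists>d>0. \<forall>x. dist l x < d \<longrightarrow> onorm (\<lambda>v. H' x v - H' l v) < e"
      using \<open>d > 0\<close> \<open>d' > 0\<close> by (intro exI[of _ "min d d'"]) auto
  qed (use dH in blast)
  obtain U where U: "open U" "U \<inter> {x\<in>S. \<gamma> x = x} = {l}"
    using l by (auto simp: isolated_in_def)
  have cont: "continuous_on S \<gamma>"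
    using f by (intro continuous_at_imp_continuous_on) (blast intro: has_derivative_continuous)
  have contH: "continuous_on S H"
    using dH by (intro continuous_at_imp_continuous_on) (blast intro: has_derivative_continuous)
  define T where "T = U \<inter> ball l r \<inter> (S \<inter> \<gamma> -` ball l r)"
  have oT: "open T" unfolding T_def
    using U \<open>open S\<close> cont by (intro open_Int continuous_open_preimage) auto
  have lT: "l \<in> T" using U r lS fixl by (auto simp: T_def)
  have TS: "T \<subseteq> S" by (auto simp: T_def)
  have "H l \<in> interior (H ` T)"
  proof (rule sussmann_open_mapping[OF \<open>open S\<close> contH lS dH[OF lS]])
    show "bounded_linear (\<lambda>x::complex^'n. (1/2) *\<^sub>R x)" by (rule bounded_linear_scaleR_right)
    show "H' l \<circ> (\<lambda>x. (1/2) *\<^sub>R x) = id" by (auto simp: H'l)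
  qed (use oT lT TS interior_open in auto)
  moreover have Hl: "H l = 0" by (simp add: H_def fixl)
  ultimately obtain e where e: "e > 0" "ball 0 e \<subseteq> H ` T"
    by (auto simp: mem_interior)
  \<comment> \<open>a nonzero fixed vector of \<open>A\<close>, small enough to be a value of \<open>H\<close> near \<open>l\<close>\<close>
  define w where "w = (e / (2 * norm v)) *\<^sub>R v"
  have w0: "w \<noteq> 0" and "norm w < e" using v0 e by (auto simp: w_def)
  have Aw: "A *v w = w" unfolding w_def
    using linear_cmul[OF bounded_linear.linear[OF bl[of A]], of _ v] by (simp add: Av)
  have "w \<in> H ` T" using e \<open>norm w < e\<close> by auto
  then obtain x where x: "x \<in> T" "w = H x" by auto
  have "H (\<gamma> x) = A *v H x"
    using x inv by (auto simp: T_def H_def matrix_vector_right_distrib AA)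
  then have "H (\<gamma> x) = H x" using Aw x by simp
  moreover have "x \<in> ball l r" "\<gamma> x \<in> ball l r" using x by (auto simp: T_def)
  ultimately have "\<gamma> x = x" using r(3) by (auto dest: inj_onD)
  then have "x = l" using x U by (auto simp: T_def)
  then show False using x w0 Hl by simp
qed

lemma holomorphic_map_on_compose:
  fixes f :: "complex^'n \<Rightarrow> complex^'m" and g :: "complex^'m \<Rightarrow> complex^'k"
  assumes "holomorphic_map_on f S" "holomorphic_map_on g T" "f ` S \<subseteq> T"
  shows "holomorphic_map_on (g \<circ> f) S"
  unfolding holomorphic_map_on_def
proof
  fix x assume x: "x \<in> S"
  obtain J where J: "(f has_derivative (\<lambda>h. J *v h)) (at x within S)"
    using assms(1) x unfolding holomorphic_map_on_def by blast
  obtain K where "(g has_derivative (\<lambda>h. K *v h)) (at (f x) within T)"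
    using assms(2,3) x unfolding holomorphic_map_on_def by blast
  then have "(g has_derivative (\<lambda>h. K *v h)) (at (f x) within f ` S)"
    using assms(3) has_derivative_subset by blast
  from has_derivative_in_compose[OF J this]
  have "(g \<circ> f has_derivative (\<lambda>h. (K ** J) *v h)) (at x within S)"
    by (simp add: o_def matrix_vector_mul_assoc)
  then show "\<exists>J. (g \<circ> f has_derivative (\<lambda>h. J *v h)) (at x within S)" by blast
qed

text \<open>Conjugating the symmetry by an automorphism moves the point of symmetry along.\<close>

lemma point_of_symmetry_automorphism:
  assumes l: "point_of_symmetry S l"
    and hol: "holomorphic_map_on f S" "holomorphic_map_on g S"
    and fS: "f ` S \<subseteq> S" and gS: "g ` S \<subseteq> S"
    and gf: "\<And>x. x \<in> S \<Longrightarrow> g (f x) = x" and fg: "\<And>x. x \<in> S \<Longrightarrow> f (g x) = x"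
  shows "point_of_symmetry S (f l)"
proof -
  obtain \<gamma> where \<gamma>: "holomorphic_map_on \<gamma> S" "\<gamma> ` S \<subseteq> S" "\<And>x. x \<in> S \<Longrightarrow> \<gamma> (\<gamma> x) = x"
    and iso: "l isolated_in {x\<in>S. \<gamma> x = x}"
    using l unfolding point_of_symmetry_def by blast
  obtain e where e: "e > 0" "\<And>x. x \<in> S \<Longrightarrow> \<gamma> x = x \<Longrightarrow> dist l x < e \<Longrightarrow> x = l"
    and lS: "l \<in> S" "\<gamma> l = l"
    using iso by (auto simp: isolated_in_dist_Ex_iff)
  let ?\<delta> = "f \<circ> (\<gamma> \<circ> g)"
  have contg: "continuous_on S g"
    using hol(2) unfolding holomorphic_map_on_def continuous_on_eq_continuous_within
    by (meson has_derivative_continuous)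
  have flS: "f l \<in> S" using fS lS by blast
  then obtain d where d: "d > 0" "\<And>y. y \<in> S \<Longrightarrow> dist y (f l) < d \<Longrightarrow> dist (g y) (g (f l)) < e"
    using contg e(1) unfolding continuous_on_iff by blast
  have "y = f l" if y: "y \<in> S" "?\<delta> y = y" "dist (f l) y < d" for y
  proof -
    have gy: "g y \<in> S" using gS y by blast
    have "\<gamma> (g y) \<in> S" using gy \<gamma>(2) by blast
    then have "\<gamma> (g y) = g y" using gf[of "\<gamma> (g y)"] y(2) by simp
    moreover have "dist l (g y) < e" using d(2)[of y] y gf[OF lS(1)] by (simp add: dist_commute)
    ultimately have "g y = l" using e(2) gy by blast
    then show ?thesis using fg y(1) by auto
  qed
  moreover have "?\<delta> (f l) = f l" using gf lS by simp
  ultimately have "f l isolated_in {x\<in>S. ?\<delta> x = x}"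
    unfolding isolated_in_dist_Ex_iff using flS d(1) by auto
  moreover have "holomorphic_map_on ?\<delta> S"
    using holomorphic_map_on_compose[OF holomorphic_map_on_compose[OF hol(2) \<gamma>(1) gS] hol(1)] gS \<gamma>(2)
    by (simp add: image_subset_iff)
  moreover have "?\<delta> ` S \<subseteq> S" using gS \<gamma>(2) fS by (simp add: image_subset_iff)
  moreover have "?\<delta> (?\<delta> x) = x" if "x \<in> S" for x
    using that gS \<gamma>(2) gf fg \<gamma>(3) by (simp add: image_subset_iff)
  ultimately show ?thesis unfolding point_of_symmetry_def by blast
qed

section \<open>The tetrablock and the symmetrized bidisc as a slice of it\<close>

text \<open>Membership in the tetrablock, as a condition on three coordinates. Curves are handled coordinate by
  coordinate below, and the same predicate describes the symmetrized bidisc through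
  \<open>(s, p) \<mapsto> (s/2, s/2, p)\<close>.\<close>

definition tetra :: "complex \<Rightarrow> complex \<Rightarrow> complex \<Rightarrow> bool" where
  "tetra x y p \<longleftrightarrow> (\<forall>z w. norm z \<le> 1 \<and> norm w \<le> 1 \<longrightarrow> 1 - x * z - y * w + p * z * w \<noteq> 0)"

lemma mem_tetrablock_iff: "x \<in> tetrablock \<longleftrightarrow> tetra (x$1) (x$2) (x$3)"
  by (simp add: tetrablock_def tetra_def)

lemma tetra_commute: "tetra x y p \<longleftrightarrow> tetra y x p"
proof -
  have "tetra y x p" if "tetra x y p" for x y
    unfolding tetra_def
  proof (intro allI impI)
    fix z w :: complex assume "norm z \<le> 1 \<and> norm w \<le> 1"
    then have "1 - x * w - y * z + p * w * z \<noteq> 0" using that unfolding tetra_def by blast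
    then show "1 - y * z - x * w + p * z * w \<noteq> 0" by (simp add: algebra_simps)
  qed
  then show ?thesis by blast
qed

lemma tetra_rotate:
  assumes "tetra x y p" "norm a = 1" "norm b = 1"
  shows "tetra (a * x) (b * y) (a * b * p)"
  unfolding tetra_def
proof (intro allI impI)
  fix z w :: complex assume "norm z \<le> 1 \<and> norm w \<le> 1"
  then have "norm (a * z) \<le> 1" "norm (b * w) \<le> 1" using assms by (auto simp: norm_mult)
  then have "1 - x * (a * z) - y * (b * w) + p * (a * z) * (b * w) \<noteq> 0"
    using assms(1) unfolding tetra_def by blast
  then show "1 - a * x * z - b * y * w + a * b * p * z * w \<noteq> 0" by (simp add: mult_ac)
qed

lemma tetra_norm_less_1: assumes "tetra x y p" shows "norm x < 1"
proof (rule ccontr)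
  assume "\<not> norm x < 1"
  then have "norm (1/x) \<le> 1" "x \<noteq> 0" by (auto simp: norm_divide divide_simps)
  then have "1 - x * (1/x) - y * 0 + p * (1/x) * 0 \<noteq> 0"
    using assms unfolding tetra_def by (metis norm_zero zero_le_one)
  then show False using \<open>x \<noteq> 0\<close> by simp
qed

text \<open>The functions \<open>(x, y, p) \<mapsto> (p w - x) / (y w - 1)\<close> with \<open>norm w = 1\<close> are the source of every bound
  below: they map the tetrablock into the disc. A value of modulus at least \<open>1\<close> would be the reciprocal of
  a forbidden \<open>z\<close> in the closed disc.\<close>

lemma tetra_Psi:
  assumes "tetra x y p" "norm w \<le> 1"
  shows "y * w - 1 \<noteq> 0" "norm ((p * w - x) / (y * w - 1)) < 1"
proof -
  have nz: "1 - x * z - y * w + p * z * w \<noteq> 0" if "norm z \<le> 1" for z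
    using assms that unfolding tetra_def by blast
  show 1: "y * w - 1 \<noteq> 0" using nz[of 0] by auto
  show "norm ((p * w - x) / (y * w - 1)) < 1"
  proof (rule ccontr)
    assume "\<not> ?thesis"
    then have le: "norm (y * w - 1) \<le> norm (p * w - x)"
      using 1 by (simp add: norm_divide divide_simps)
    then have "p * w - x \<noteq> 0" using 1 by auto
    define z where "z = (y * w - 1) / (p * w - x)"
    have "norm z \<le> 1"
      using le \<open>p * w - x \<noteq> 0\<close> by (simp add: z_def norm_divide divide_simps)
    moreover have "z * (p * w - x) = y * w - 1" using \<open>p * w - x \<noteq> 0\<close> by (simp add: z_def)
    then have "1 - x * z - y * w + p * z * w = 0" by algebra
    ultimately show False using nz by blast
  qed
qed

text \<open>The left side of the defining condition is the average of \<open>(1 - z0 z)(1 - w0 w)\<close> and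
  \<open>(1 - z0 w)(1 - w0 z)\<close>. For \<open>z \<noteq> w\<close> and \<open>T a = a / (1 - a w)\<close>, its vanishing says that the midpoint of \<open>T z0\<close> and
  \<open>T w0\<close> equals \<open>1 / (z - w)\<close>. But \<open>T\<close> maps the unit disc onto a disc or half-plane that does not contain
  \<open>1 / (z - w)\<close>, and such sets are convex.\<close>

lemma tetra_symmetrization:
  assumes z0: "norm z0 < 1" and w0: "norm w0 < 1"
  shows "tetra ((z0 + w0) / 2) ((z0 + w0) / 2) (z0 * w0)"
  unfolding tetra_def
proof (intro allI impI notI)
  fix z w :: complex assume zw: "norm z \<le> 1 \<and> norm w \<le> 1"
  assume "1 - (z0 + w0) / 2 * z - (z0 + w0) / 2 * w + z0 * w0 * z * w = 0"
  then have eq: "(1 - z0 * z) * (1 - w0 * w) + (1 - z0 * w) * (1 - w0 * z) = 0"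
    by (simp add: add_divide_distrib) algebra
  have small: "norm (a * b) < 1" if "norm a < 1" "norm b \<le> 1" for a b :: complex
    using mult_left_le[of "norm b" "norm a"] that by (simp add: norm_mult)
  have nz: "1 - a * b \<noteq> 0" if "norm a < 1" "norm b \<le> 1" for a b :: complex
    using small[OF that] by auto
  have norm1: "(norm (1 + u))\<^sup>2 = 1 + 2 * Re u + (norm u)\<^sup>2" for u
    by (simp only: cmod_power2) (simp add: power2_eq_square algebra_simps)
  define T where "T a = a / (1 - a * w)" for a
  have T: "(norm (T a))\<^sup>2 * (1 - (norm w)\<^sup>2) - 2 * Re (T a * w) - 1 < 0" if a: "norm a < 1" for a
  proof -
    have "1 + T a * w = 1 / (1 - a * w)" "T a = a / (1 - a * w)"
      using nz[OF a, of w] zw by (simp_all add: T_def divide_simps)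
    then have "norm (T a) < norm (1 + T a * w)"
      using a nz[OF a, of w] zw by (simp add: norm_divide divide_strict_right_mono)
    then have "(norm (T a))\<^sup>2 < (norm (1 + T a * w))\<^sup>2" by (simp add: power_strict_mono)
    also have "\<dots> = 1 + 2 * Re (T a * w) + (norm (T a))\<^sup>2 * (norm w)\<^sup>2"
      by (simp only: norm1 norm_mult power_mult_distrib)
    finally show ?thesis by (simp add: algebra_simps)
  qed
  define \<eta> where "\<eta> = (T z0 + T w0) / 2"
  have "(norm \<eta>)\<^sup>2 \<le> ((norm (T z0))\<^sup>2 + (norm (T w0))\<^sup>2) / 2"
  proof -
    have "norm \<eta> \<le> (norm (T z0) + norm (T w0)) / 2"
      unfolding \<eta>_def using norm_triangle_ineq[of "T z0" "T w0"] by (simp add: norm_divide)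
    then have "(norm \<eta>)\<^sup>2 \<le> ((norm (T z0) + norm (T w0)) / 2)\<^sup>2" by (simp add: power_mono)
    also have "\<dots> \<le> ((norm (T z0))\<^sup>2 + (norm (T w0))\<^sup>2) / 2"
      using sum_squares_bound[of "norm (T z0)" "norm (T w0)"] by (simp add: power2_eq_square field_simps)
    finally show ?thesis .
  qed
  moreover have "0 \<le> 1 - (norm w)\<^sup>2" using zw by (simp add: power_le_one)
  ultimately have "(norm \<eta>)\<^sup>2 * (1 - (norm w)\<^sup>2) \<le> ((norm (T z0))\<^sup>2 + (norm (T w0))\<^sup>2) / 2 * (1 - (norm w)\<^sup>2)"
    by (rule mult_right_mono)
  moreover have "Re (\<eta> * w) = (Re (T z0 * w) + Re (T w0 * w)) / 2"
    by (simp add: \<eta>_def field_simps)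
  ultimately have \<eta>1: "(norm \<eta>)\<^sup>2 * (1 - (norm w)\<^sup>2) - 2 * Re (\<eta> * w) - 1 < 0"
    using T[OF z0] T[OF w0] by (simp add: field_simps)
  have "(norm (1 + \<eta> * w))\<^sup>2 = 1 + 2 * Re (\<eta> * w) + (norm \<eta>)\<^sup>2 * (norm w)\<^sup>2"
    by (simp only: norm1 norm_mult power_mult_distrib)
  then have "(norm \<eta>)\<^sup>2 < (norm (1 + \<eta> * w))\<^sup>2" using \<eta>1 by (simp add: algebra_simps)
  then have \<eta>2: "norm \<eta> < norm (1 + \<eta> * w)" by (simp add: power2_less_imp_less)
  have "(w - z) * \<eta> = -1"
  proof -
    have n: "1 - z0 * w \<noteq> 0" "1 - w0 * w \<noteq> 0" using nz z0 w0 zw by blast+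
    then have "T z0 * (1 - z0 * w) = z0" "T w0 * (1 - w0 * w) = w0"
      by (auto simp: T_def)
    moreover have "((1 - z0 * w) * (1 - w0 * w)) * (2 * ((w - z) * \<eta> + 1))
        = (w - z) * ((T z0 * (1 - z0 * w)) * (1 - w0 * w) + (T w0 * (1 - w0 * w)) * (1 - z0 * w))
          + 2 * ((1 - z0 * w) * (1 - w0 * w))"
    proof -
      have "2 * ((w - z) * \<eta> + 1) = (w - z) * (T z0 + T w0) + 2" by (simp add: \<eta>_def)
      then show ?thesis by (simp only:) (simp add: algebra_simps)
    qed
    ultimately have "((1 - z0 * w) * (1 - w0 * w)) * (2 * ((w - z) * \<eta> + 1))
        = (w - z) * (z0 * (1 - w0 * w) + w0 * (1 - z0 * w)) + 2 * ((1 - z0 * w) * (1 - w0 * w))"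
      by simp
    also have "\<dots> = 0" using eq by algebra
    finally have "((1 - z0 * w) * (1 - w0 * w)) * (2 * ((w - z) * \<eta> + 1)) = 0" .
    then have "2 * ((w - z) * \<eta> + 1) = 0" using n by (metis mult_eq_0_iff)
    then have "(w - z) * \<eta> + 1 = 0" by (metis mult_eq_0_iff zero_neq_numeral)
    then show ?thesis by algebra
  qed
  then have "1 + \<eta> * w = \<eta> * z" by algebra
  then have "norm \<eta> < norm \<eta> * norm z" using \<eta>2 by (simp add: norm_mult)
  then show False using zw mult_left_le[of "norm z" "norm \<eta>"] by simp
qed

text \<open>Putting \<open>z = w\<close> in the defining condition shows that the reciprocals of the roots of
  \<open>X\<^sup>2 - s X + p\<close> avoid the closed disc.\<close>

lemma symmetrization_of_tetra:
  assumes "tetra (s/2) (s/2) p"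
  obtains z w where "norm z < 1" "norm w < 1" "s = z + w" "p = z * w"
proof -
  have nz: "1 - s * z + p * z\<^sup>2 \<noteq> 0" if "norm z \<le> 1" for z
  proof -
    have "1 - s / 2 * z - s / 2 * z + p * z * z \<noteq> 0"
      using assms that unfolding tetra_def by blast
    then show ?thesis by (simp add: power2_eq_square algebra_simps)
  qed
  define d where "d = csqrt (s\<^sup>2 - 4 * p)"
  have d2: "d\<^sup>2 = s\<^sup>2 - 4 * p" by (simp add: d_def)
  have root: "norm r < 1" if "r\<^sup>2 - s * r + p = 0" for r
  proof (rule ccontr)
    assume "\<not> norm r < 1"
    then have "norm (1/r) \<le> 1" "r \<noteq> 0" by (auto simp: norm_divide divide_simps)
    have "1 - s * (1/r) + p * (1/r)\<^sup>2 = (r\<^sup>2 - s * r + p) / r\<^sup>2"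
      using \<open>r \<noteq> 0\<close> by (simp add: field_simps power2_eq_square)
    then show False using nz[OF \<open>norm (1/r) \<le> 1\<close>] that by simp
  qed
  show ?thesis
  proof
    show "s = (s + d) / 2 + (s - d) / 2" by (simp add: field_simps)
    show "p = (s + d) / 2 * ((s - d) / 2)"
      using d2 by (simp add: square_diff_square_factored[symmetric] power2_eq_square)
    have "((s + d) / 2)\<^sup>2 - s * ((s + d) / 2) + p = (d\<^sup>2 - s\<^sup>2 + 4 * p) / 4"
      "((s - d) / 2)\<^sup>2 - s * ((s - d) / 2) + p = (d\<^sup>2 - s\<^sup>2 + 4 * p) / 4"
      by (simp_all add: power2_eq_square field_simps)
    then show "norm ((s + d) / 2) < 1" "norm ((s - d) / 2) < 1"
      by (intro root; simp add: d2)+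
  qed
qed

lemma vector_2_eta: "vector [x $ 1, x $ 2] = (x :: complex^2)"
  by (simp add: vec_eq_iff forall_2)

lemma mem_symmetrized_bidisc_iff:
  "x \<in> symmetrized_bidisc \<longleftrightarrow> tetra (x$1 / 2) (x$1 / 2) (x$2)"
proof
  assume "x \<in> symmetrized_bidisc"
  then show "tetra (x$1 / 2) (x$1 / 2) (x$2)"
    unfolding symmetrized_bidisc_def using tetra_symmetrization by auto
next
  assume "tetra (x$1 / 2) (x$1 / 2) (x$2)"
  then obtain z w where *: "norm z < 1" "norm w < 1" "x$1 = z + w" "x$2 = z * w"
    by (rule symmetrization_of_tetra)
  have "x = vector [z + w, z * w]" using *(3,4) vector_2_eta[of x] by simp
  then show "x \<in> symmetrized_bidisc"
    unfolding symmetrized_bidisc_def using * by auto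
qed

text \<open>The forbidden parameters range over a compact bidisc, so the tube lemma applies.\<close>

lemma open_tetra:
  fixes a b c :: "'a::t2_space \<Rightarrow> complex"
  assumes "continuous_on UNIV a" "continuous_on UNIV b" "continuous_on UNIV c"
  shows "open {x. tetra (a x) (b x) (c x)}"
proof -
  let ?K = "cball 0 1 \<times> cball 0 1 :: (complex \<times> complex) set"
  let ?F = "\<lambda>x (u::complex \<times> complex). 1 - a x * fst u - b x * snd u + c x * fst u * snd u"
  have "open {x. \<forall>u\<in>?K. ?F x u \<noteq> 0}"
  proof (subst open_subopen, intro allI impI ballI)
    fix x assume x: "x \<in> {x. \<forall>u\<in>?K. ?F x u \<noteq> 0}"
    let ?W = "{v::'a \<times> (complex \<times> complex). ?F (fst v) (snd v) \<noteq> 0}"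
    have comp: "continuous_on UNIV (\<lambda>v::'a \<times> (complex \<times> complex). f (fst v))"
      if "continuous_on UNIV f" for f :: "'a \<Rightarrow> complex"
      using continuous_on_compose2[OF that continuous_on_fst[OF continuous_on_id]] by auto
    have "open ?W"
      by (intro open_Collect_neq continuous_intros comp assms)
    moreover have "{x} \<times> ?K \<subseteq> ?W" using x by auto
    moreover have "compact ?K" by (intro compact_Times compact_cball)
    ultimately have "\<exists>X. x \<in> X \<and> open X \<and> X \<times> ?K \<subseteq> ?W"
      by (intro Elementary_Topology.tube_lemma)
    then obtain X where X: "x \<in> X" "open X" "X \<times> ?K \<subseteq> ?W" by blast
    have "?F y u \<noteq> 0" if "y \<in> X" "u \<in> ?K" for y u
    proof -
      have "(y, u) \<in> ?W" using X(3) that by blast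
      then show ?thesis by simp
    qed
    then show "\<exists>T. open T \<and> x \<in> T \<and> T \<subseteq> {x. \<forall>u\<in>?K. ?F x u \<noteq> 0}"
      using X(1,2) by blast
  qed
  moreover have "{x. tetra (a x) (b x) (c x)} = {x. \<forall>u\<in>?K. ?F x u \<noteq> 0}"
    by (auto simp: tetra_def)
  ultimately show ?thesis by simp
qed

lemma open_tetrablock: "open tetrablock"
proof -
  have "tetrablock = {x. tetra (x$1) (x$2) (x$3)}" by (auto simp: mem_tetrablock_iff)
  moreover have "open \<dots>" by (intro open_tetra continuous_intros)
  ultimately show ?thesis by simp
qed

lemma open_symmetrized_bidisc: "open symmetrized_bidisc"
proof -
  have "symmetrized_bidisc = {x. tetra (1/2 * x$1) (1/2 * x$1) (x$2)}" by (auto simp: mem_symmetrized_bidisc_iff)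
  moreover have "open \<dots>" by (intro open_tetra continuous_intros)
  ultimately show ?thesis by simp
qed

section \<open>Discs in the tetrablock\<close>

abbreviation mob :: "complex \<Rightarrow> complex \<Rightarrow> complex" where
  "mob \<equiv> Moebius_function 0"

lemma mob_denominator_nonzero:
  assumes "norm w < 1" "norm z < 1"
  shows "1 - cnj w * z \<noteq> 0"
  using assms norm_mult_less[of "cnj w" 1 z 1] by auto

lemma mob_has_field_derivative:
  assumes "norm w < 1" "norm z < 1"
  shows "(mob w has_field_derivative of_real (1 - (norm w)\<^sup>2) / (1 - cnj w * z)\<^sup>2) (at z)"
proof -
  have "((\<lambda>z. (z - w) / (1 - cnj w * z)) has_field_derivative
      (1 * (1 - cnj w * z) - (z - w) * (- cnj w)) / ((1 - cnj w * z) * (1 - cnj w * z))) (at z)"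
    using mob_denominator_nonzero[OF assms] by (auto intro!: derivative_eq_intros)
  moreover have "1 * (1 - cnj w * z) - (z - w) * (- cnj w) = of_real (1 - (norm w)\<^sup>2)"
    using complex_norm_square[of w] by (simp add: algebra_simps)
  moreover have "mob w = (\<lambda>z. (z - w) / (1 - cnj w * z))" by (simp add: fun_eq_iff Moebius_function_simple)
  ultimately show ?thesis by (simp only: power2_eq_square)
qed

lemma Schwarz_Pick_derivative:
  assumes hol: "g holomorphic_on ball 0 1" and bd: "\<And>z. norm z < 1 \<Longrightarrow> norm (g z) < 1"
    and D: "(g has_field_derivative D) (at 0)"
  shows "norm D \<le> 1 - (norm (g 0))\<^sup>2"
proof -
  define h where "h = mob (g 0) \<circ> g"
  have g0: "norm (g 0) < 1" using bd by simp
  have "h holomorphic_on ball 0 1"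
    unfolding h_def by (rule holomorphic_on_compose_gen[OF hol Moebius_function_holomorphic[OF g0]]) (use bd in auto)
  moreover have "h 0 = 0" by (simp add: h_def Moebius_function_eq_zero)
  moreover have "norm (h z) < 1" if "norm z < 1" for z
    using Moebius_function_norm_lt_1[OF g0 bd[OF that]] by (simp add: h_def)
  ultimately have "norm (deriv h 0) \<le> 1" by (rule Schwarz_Lemma(2)[where \<xi> = 0]) auto
  moreover define k where "k = 1 - (norm (g 0))\<^sup>2"
  have "(h has_field_derivative of_real k / (1 - cnj (g 0) * g 0)\<^sup>2 * D) (at 0)"
    unfolding h_def k_def by (rule DERIV_chain[OF mob_has_field_derivative[OF g0 g0] D])
  moreover have "1 - cnj (g 0) * g 0 = of_real k"
    using complex_norm_square[of "g 0"] by (simp add: k_def mult.commute)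
  moreover have "k > 0" using g0 by (simp add: k_def power_less_one_iff)
  ultimately have "norm (of_real k / (of_real k)\<^sup>2 * D) \<le> 1" using DERIV_imp_deriv by metis
  then have "norm D \<le> k" using \<open>k > 0\<close>
    by (simp add: norm_mult norm_divide norm_power power2_eq_square divide_simps)
  then show ?thesis by (simp add: k_def)
qed

text \<open>A self-map of the disc that fixes \<open>a\<close> with derivative \<open>-1\<close> is the Moebius involution about \<open>a\<close>: after
  moving \<open>a\<close> to \<open>0\<close> this is the equality case of the Schwarz lemma.\<close>

lemma disc_involution_unique:
  assumes hol: "g holomorphic_on ball 0 1" and bd: "\<And>z. norm z < 1 \<Longrightarrow> norm (g z) < 1"
    and a: "norm a < 1" "g a = a" and D: "(g has_field_derivative -1) (at a)"
    and z: "norm z < 1"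
  shows "g z = mob (-a) (- mob a z)"
proof -
  define h where "h = mob a \<circ> (g \<circ> mob (-a))"
  have ma: "norm (-a) < 1" using a by simp
  have m0: "mob (-a) 0 = a" by (simp add: Moebius_function_of_zero)
  have "h holomorphic_on ball 0 1"
    unfolding h_def
    by (intro holomorphic_on_compose_gen[where t = "ball 0 1"] hol Moebius_function_holomorphic a ma)
      (use bd Moebius_function_norm_lt_1[OF ma] in auto)
  moreover have h0: "h 0 = 0" by (simp add: h_def m0 a Moebius_function_eq_zero)
  moreover have "norm (h z) < 1" if "norm z < 1" for z
    using Moebius_function_norm_lt_1[OF a(1) bd[OF Moebius_function_norm_lt_1[OF ma that]]] by (simp add: h_def)
  ultimately have Schwarz: "(\<exists>z. norm z < 1 \<and> z \<noteq> 0 \<and> norm (h z) = norm z) \<or> norm (deriv h 0) = 1 \<Longrightarrow>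
      \<exists>\<alpha>. (\<forall>z. norm z < 1 \<longrightarrow> h z = \<alpha> * z) \<and> norm \<alpha> = 1"
    by (rule Schwarz_Lemma(3)[where \<xi> = 0]) auto
  define k where "k = 1 - (norm a)\<^sup>2"
  have k: "k > 0" using a by (simp add: k_def power_less_one_iff)
  have kk: "1 - cnj a * a = of_real k" using complex_norm_square[of a] by (simp add: k_def mult.commute)
  have D1: "(mob a has_field_derivative of_real k / (of_real k)\<^sup>2) (at a)"
    using mob_has_field_derivative[OF a(1) a(1)] by (simp add: kk flip: k_def)
  have D2: "(mob (-a) has_field_derivative of_real k) (at 0)"
    using mob_has_field_derivative[OF ma, of 0] by (simp add: k_def)
  have "((g \<circ> mob (-a)) has_field_derivative (-1) * of_real k) (at 0)"
    by (rule DERIV_chain[OF _ D2]) (simp add: m0 D)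
  then have "(h has_field_derivative (of_real k / (of_real k)\<^sup>2) * ((-1) * of_real k)) (at 0)"
    unfolding h_def by (rule DERIV_chain[rotated]) (simp add: m0 a D1)
  then have Dh: "(h has_field_derivative -1) (at 0)" using k by (simp add: power2_eq_square)
  then have "norm (deriv h 0) = 1" using DERIV_imp_deriv by fastforce
  then obtain \<alpha> where \<alpha>: "\<And>z. norm z < 1 \<Longrightarrow> h z = \<alpha> * z" using Schwarz by blast
  have "(h has_field_derivative \<alpha>) (at 0)"
  proof (rule has_field_derivative_transform_within_open[of "\<lambda>z. \<alpha> * z" _ _ "ball 0 1"])
    show "((*) \<alpha> has_field_derivative \<alpha>) (at 0)" by (auto intro!: derivative_eq_intros)
  qed (use \<alpha> in auto)
  then have "\<alpha> = -1" using Dh DERIV_unique by blast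
  define u where "u = mob a z"
  have u: "norm u < 1" "mob (-a) u = z"
    using Moebius_function_norm_lt_1[OF a(1) z] Moebius_function_compose[of "-a" a z] a z by (auto simp: u_def)
  have "h u = - u" using \<alpha> u \<open>\<alpha> = -1\<close> by simp
  then have "mob a (g z) = - u" by (simp add: h_def u)
  moreover have "mob (-a) (mob a (g z)) = g z"
    using Moebius_function_compose[of "-a" a "g z"] a bd[OF z] by simp
  ultimately show ?thesis by (simp add: u_def)
qed

lemma Psi_has_field_derivative:
  assumes "(f1 has_field_derivative y1) (at b)" "(f2 has_field_derivative y2) (at b)"
    "(f3 has_field_derivative x) (at b)" and "f1 b = 0" "f2 b = 0"
  shows "((\<lambda>t. (f3 t * w - f1 t) / (f2 t * w - 1)) has_field_derivative - (x * w - y1) - f3 b * w * (y2 * w)) (at b)"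
  using assms by (auto intro!: derivative_eq_intros)

lemma Psi_disc:
  assumes hol: "f1 holomorphic_on ball 0 1" "f2 holomorphic_on ball 0 1" "f3 holomorphic_on ball 0 1"
    and mem: "\<And>t. norm t < 1 \<Longrightarrow> tetra (f1 t) (f2 t) (f3 t)" and w: "norm w = 1"
  shows "(\<lambda>t. (f3 t * w - f1 t) / (f2 t * w - 1)) holomorphic_on ball 0 1"
    and "\<And>t. norm t < 1 \<Longrightarrow> norm ((f3 t * w - f1 t) / (f2 t * w - 1)) < 1"
proof -
  show "(\<lambda>t. (f3 t * w - f1 t) / (f2 t * w - 1)) holomorphic_on ball 0 1"
    using tetra_Psi(1)[OF mem] w by (intro holomorphic_intros hol) auto
  show "norm ((f3 t * w - f1 t) / (f2 t * w - 1)) < 1" if "norm t < 1" for t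
    using tetra_Psi(2)[OF mem[OF that]] w by simp
qed

text \<open>A lower bound for the size of tangent vectors: Schwarz-Pick applied to the composition of a disc in the tetrablock with
  the function of \<open>tetra_Psi\<close>. The unimodular \<open>w\<close> is free, which makes this a family of inequalities for a
  single tangent vector.\<close>

lemma tetra_disc_derivative_bound:
  assumes hol: "f1 holomorphic_on ball 0 1" "f2 holomorphic_on ball 0 1" "f3 holomorphic_on ball 0 1"
    and mem: "\<And>t. norm t < 1 \<Longrightarrow> tetra (f1 t) (f2 t) (f3 t)"
    and 0: "f1 0 = 0" "f2 0 = 0"
    and D: "(f1 has_field_derivative y1) (at 0)" "(f2 has_field_derivative y2) (at 0)"
      "(f3 has_field_derivative x) (at 0)"
    and w: "norm w = 1"
  shows "norm (x - (cnj w * y1 - f3 0 * w * y2)) \<le> 1 - (norm (f3 0))\<^sup>2"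
proof -
  have "norm (- (x * w - y1) - f3 0 * w * (y2 * w)) \<le> 1 - (norm ((f3 0 * w - f1 0) / (f2 0 * w - 1)))\<^sup>2"
    by (rule Schwarz_Pick_derivative[OF Psi_disc[OF hol mem w] Psi_has_field_derivative[OF D 0]])
  moreover have "w * cnj w = 1" using w complex_norm_square[of w] by simp
  then have "- (x * w - y1) - f3 0 * w * (y2 * w) = - (w * (x - (cnj w * y1 - f3 0 * w * y2)))"
    by (simp add: algebra_simps)
  ultimately show ?thesis using w by (simp add: 0 norm_mult)
qed

text \<open>Every function of \<open>tetra_Psi\<close> turns the disc into a self-map of \<open>ball 0 1\<close> that must be the Moebius
  involution about \<open>a\<close>, up to the factor \<open>- w\<close>. Comparing \<open>w = 1\<close> and \<open>w = -1\<close>, and exchanging the first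
  two coordinates, leaves only the flat solution.\<close>

lemma flat_disc_rigidity:
  assumes hol: "f1 holomorphic_on ball 0 1" "f2 holomorphic_on ball 0 1" "f3 holomorphic_on ball 0 1"
    and mem: "\<And>t. norm t < 1 \<Longrightarrow> tetra (f1 t) (f2 t) (f3 t)"
    and a: "norm a < 1" "f1 a = 0" "f2 a = 0" "f3 a = a"
    and D: "(f1 has_field_derivative 0) (at a)" "(f2 has_field_derivative 0) (at a)"
      "(f3 has_field_derivative -1) (at a)"
    and t: "norm t < 1"
  shows "f1 t = 0 \<and> f2 t = 0 \<and> f3 t = mob (-a) (- mob a t)"
proof -
  define m where "m = mob (-a) (- mob a t)"
  have m1: "norm m < 1"
    unfolding m_def using a t by (intro Moebius_function_norm_lt_1) (simp_all add: Moebius_function_norm_lt_1)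
  have key: "f3 t * w - f1 t = - w * m * (f2 t * w - 1)"
    if hol: "f1 holomorphic_on ball 0 1" "f2 holomorphic_on ball 0 1"
      and mem: "\<And>t. norm t < 1 \<Longrightarrow> tetra (f1 t) (f2 t) (f3 t)" and 0: "f1 a = 0" "f2 a = 0"
      and D1: "(f1 has_field_derivative 0) (at a)" "(f2 has_field_derivative 0) (at a)" and w: "norm w = 1"
    for f1 f2 w
  proof -
    define g where "g t = - cnj w * ((f3 t * w - f1 t) / (f2 t * w - 1))" for t
    have ww: "w * cnj w = 1" using w complex_norm_square[of w] by simp
    have "g t = mob (-a) (- mob a t)"
    proof (rule disc_involution_unique)
      show "g holomorphic_on ball 0 1" unfolding g_def
        by (intro holomorphic_intros Psi_disc(1)[OF hol assms(3) mem w])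
      show "norm (g z) < 1" if "norm z < 1" for z
        using Psi_disc(2)[OF hol assms(3) mem w that] w
        unfolding g_def norm_mult norm_minus_cancel complex_mod_cnj by simp
      show "g a = a" using ww by (simp add: g_def 0 a mult.commute[of "cnj w"])
      have "(g has_field_derivative - cnj w * (- (-1 * w - 0) - f3 a * w * (0 * w))) (at a)"
        unfolding g_def by (intro DERIV_cmult Psi_has_field_derivative D1 D(3) 0)
      then show "(g has_field_derivative -1) (at a)" using ww by (simp add: mult.commute)
    qed (use a t in auto)
    then have "- cnj w * ((f3 t * w - f1 t) / (f2 t * w - 1)) = m" by (simp add: g_def m_def)
    then have "- (w * cnj w) * ((f3 t * w - f1 t) / (f2 t * w - 1)) = w * m"
      by (metis mult.assoc mult_minus_left mult_minus_right)
    then have "(f3 t * w - f1 t) / (f2 t * w - 1) = - w * m"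
      using ww by (metis minus_equation_iff mult_1 mult_minus_left)
    then show ?thesis using tetra_Psi(1)[OF mem[OF t], of w] w by (metis nonzero_divide_eq_eq order_refl)
  qed
  note k = key[OF hol(1,2) mem a(2,3) D(1,2)]
  note k' = key[OF hol(2,1) _ a(3,2) D(2,1)]
  have f1: "f1 t = m * f2 t" and f3: "f3 t = m"
  proof -
    have "f3 t - f1 t = - m * (f2 t - 1)" "- f3 t - f1 t = m * (- f2 t - 1)"
      using k[of 1] k[of "-1"] by simp_all
    then have "2 * f1 t = 2 * (m * f2 t)" "2 * f3 t = 2 * m" by algebra+
    then show "f1 t = m * f2 t" "f3 t = m" by simp_all
  qed
  have f2: "f2 t = m * f1 t"
  proof -
    have "f3 t - f2 t = - m * (f1 t - 1)" "- f3 t - f2 t = m * (- f1 t - 1)"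
      using k'[of 1] k'[of "-1"] mem tetra_commute by simp_all
    then have "2 * f2 t = 2 * (m * f1 t)" by algebra
    then show ?thesis by simp
  qed
  have "f1 t * (1 - m\<^sup>2) = 0" using f1 f2 by algebra
  moreover have "1 - m\<^sup>2 \<noteq> 0"
  proof
    assume "1 - m\<^sup>2 = 0"
    then have "(norm m)\<^sup>2 = 1" by (metis eq_iff_diff_eq_0 norm_one norm_power)
    then show False using m1 norm_ge_zero[of m] by (auto simp: power2_eq_1_iff)
  qed
  ultimately have "f1 t = 0" by simp
  then show ?thesis using f2 f3 by (simp add: m_def)
qed

text \<open>Explicit discs through the flat point \<open>(0, q)\<close>: symmetrize two disc automorphisms that start at the
  two square roots of \<open>- q\<close> and are rotated by \<open>C + i S\<close> and its conjugate. For \<open>S = 0\<close> the disc is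
  tangent to the direction transverse to the flat disc; \<open>S\<close> tilts it towards the
  flat direction at only second-order cost in the transverse size \<open>C\<close>.\<close>

lemma symmetrized_bidisc_disc:
  fixes C S :: real
  assumes q: "norm q < 1" and \<rho>: "\<rho>\<^sup>2 = - q" and CS: "C\<^sup>2 + S\<^sup>2 = 1"
  obtains s p where "s holomorphic_on ball 0 1" "p holomorphic_on ball 0 1"
    "\<And>t. norm t < 1 \<Longrightarrow> \<exists>z w. norm z < 1 \<and> norm w < 1 \<and> s t = z + w \<and> p t = z * w"
    "s 0 = 0" "p 0 = q"
    "(s has_field_derivative 2 * of_real ((1 - norm q) * C)) (at 0)"
    "(p has_field_derivative of_real (1 - norm q) * (- 2 * \<i> * of_real S * \<rho>)) (at 0)"
proof -
  define u where "u = Complex C S"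
  have u: "norm u = 1" using CS by (simp add: u_def cmod_def)
  have n\<rho>: "(norm \<rho>)\<^sup>2 = norm q" using \<rho> by (metis norm_minus_cancel norm_power)
  then have \<rho>1: "norm \<rho> < 1" using q by (metis abs_norm_cancel abs_square_less_1)
  define z where "z t = mob (-\<rho>) (u * t)" for t
  define w where "w t = mob \<rho> (cnj u * t)" for t
  have bz: "norm (z t) < 1" and bw: "norm (w t) < 1" if "norm t < 1" for t
    unfolding z_def w_def using \<rho>1 u that by (auto intro!: Moebius_function_norm_lt_1 simp: norm_mult)
  have Dz: "(z has_field_derivative of_real (1 - norm q) * u) (at 0)"
  proof -
    have "(mob (-\<rho>) has_field_derivative of_real (1 - norm q)) (at (u * 0))"
      using mob_has_field_derivative[of "-\<rho>" 0] \<rho>1 by (simp add: n\<rho>)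
    then show ?thesis unfolding z_def
      by (rule DERIV_chain2) (auto intro!: derivative_eq_intros)
  qed
  have Dw: "(w has_field_derivative of_real (1 - norm q) * cnj u) (at 0)"
  proof -
    have "(mob \<rho> has_field_derivative of_real (1 - norm q)) (at (cnj u * 0))"
      using mob_has_field_derivative[of "\<rho>" 0] \<rho>1 by (simp add: n\<rho>)
    then show ?thesis unfolding w_def
      by (rule DERIV_chain2) (auto intro!: derivative_eq_intros)
  qed
  have z0: "z 0 = \<rho>" and w0: "w 0 = - \<rho>" by (simp_all add: z_def w_def Moebius_function_of_zero)
  have hz: "z holomorphic_on ball 0 1"
    using holomorphic_on_compose_gen[of "\<lambda>t. u * t" "ball 0 1" "mob (-\<rho>)" "ball 0 1"] Moebius_function_holomorphic[of "-\<rho>" 0] \<rho>1 u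
    unfolding z_def o_def by (auto simp: image_subset_iff norm_mult intro!: holomorphic_intros)
  have hw: "w holomorphic_on ball 0 1"
    using holomorphic_on_compose_gen[of "\<lambda>t. cnj u * t" "ball 0 1" "mob \<rho>" "ball 0 1"] Moebius_function_holomorphic[of "\<rho>" 0] \<rho>1 u
    unfolding w_def o_def by (auto simp: image_subset_iff norm_mult intro!: holomorphic_intros)
  show ?thesis
  proof (rule that[of "\<lambda>t. z t + w t" "\<lambda>t. z t * w t"])
    show "(\<lambda>t. z t + w t) holomorphic_on ball 0 1" "(\<lambda>t. z t * w t) holomorphic_on ball 0 1"
      by (intro holomorphic_intros hz hw)+
    show "\<And>t. norm t < 1 \<Longrightarrow> \<exists>z' w'. norm z' < 1 \<and> norm w' < 1 \<and> z t + w t = z' + w' \<and> z t * w t = z' * w'"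
      using bz bw by blast
    show "z 0 + w 0 = 0" "z 0 * w 0 = q" using \<rho> by (simp_all add: z0 w0 power2_eq_square)
    have uu: "u + cnj u = 2 * of_real C" "cnj u - u = - 2 * \<i> * of_real S"
      by (simp_all add: u_def complex_eq_iff)
    have "((\<lambda>t. z t + w t) has_field_derivative of_real (1 - norm q) * u + of_real (1 - norm q) * cnj u) (at 0)"
      by (intro DERIV_add Dz Dw)
    then show "((\<lambda>t. z t + w t) has_field_derivative 2 * of_real ((1 - norm q) * C)) (at 0)"
      using uu(1) by (simp add: mult.left_commute flip: distrib_left)
    have "((\<lambda>t. z t * w t) has_field_derivative of_real (1 - norm q) * u * w 0 + of_real (1 - norm q) * cnj u * z 0) (at 0)"
      by (intro DERIV_mult Dz Dw)
    moreover have "of_real (1 - norm q) * u * w 0 + of_real (1 - norm q) * cnj u * z 0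
        = of_real (1 - norm q) * ((cnj u - u) * \<rho>)"
      by (simp add: z0 w0 algebra_simps)
    ultimately show "((\<lambda>t. z t * w t) has_field_derivative of_real (1 - norm q) * (- 2 * \<i> * of_real S * \<rho>)) (at 0)"
      by (simp only: uu(2))
  qed
qed

text \<open>The image of the unit circle under \<open>w \<mapsto> cnj w * a + w * b\<close> is an ellipse with major semi-axis
  \<open>norm a + norm b\<close>; the last claim records the direction of the major axis.\<close>

lemma align_phases:
  obtains w :: complex where "norm w = 1" "norm (cnj w * a + w * b) = norm a + norm b"
    "\<lbrakk>a \<noteq> 0; b \<noteq> 0\<rbrakk> \<Longrightarrow> \<exists>r>0. (cnj w * a + w * b)\<^sup>2 = of_real r * (a * b)"
proof (cases "a = 0 \<or> b = 0")
  case True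
  then show ?thesis by (intro that[of 1]) auto
next
  case False
  then have nz: "a \<noteq> 0" "b \<noteq> 0" by auto
  define w where "w = csqrt (sgn a * cnj (sgn b))"
  have w2: "w\<^sup>2 = sgn a * cnj (sgn b)" by (simp add: w_def)
  then have "(norm w)\<^sup>2 = 1" using nz by (metis norm_power norm_mult complex_mod_cnj norm_sgn mult_1 )
  then have w: "norm w = 1" using norm_ge_zero[of w] by (auto simp: power2_eq_1_iff)
  have ww: "w * cnj w = 1" using w complex_norm_square[of w] by simp
  have sb: "sgn b * cnj (sgn b) = 1" using complex_norm_square[of "sgn b"] nz by (simp add: norm_sgn)
  have a: "a = of_real (norm a) * sgn a" and b: "b = of_real (norm b) * sgn b"
    using nz by (simp_all add: sgn_div_norm scaleR_conv_of_real)
  have "w * sgn b = cnj w * (w\<^sup>2 * sgn b)" using ww by (simp add: power2_eq_square algebra_simps) 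
  also have "\<dots> = cnj w * sgn a" using sb by (simp add: w2 algebra_simps)
  finally have e: "w * sgn b = cnj w * sgn a" .
  have \<eta>: "cnj w * a + w * b = of_real (norm a + norm b) * (cnj w * sgn a)"
  proof -
    have "cnj w * a + w * b = of_real (norm a) * (cnj w * sgn a) + of_real (norm b) * (w * sgn b)"
      using arg_cong2[OF a b, of "\<lambda>a' b'. cnj w * a' + w * b'"] by (simp add: mult_ac)
    then show ?thesis by (simp add: e distrib_right)
  qed
  have "(cnj w * sgn a)\<^sup>2 = (cnj w * sgn a) * (w * sgn b)" by (simp add: e power2_eq_square)
  also have "\<dots> = sgn a * sgn b" using ww by (simp add: mult_ac)
  finally have e2: "(cnj w * sgn a)\<^sup>2 = sgn a * sgn b" .
  show ?thesis
  proof (rule that[OF w])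
    show "norm (cnj w * a + w * b) = norm a + norm b"
      unfolding \<eta> using w nz by (simp add: norm_mult norm_sgn flip: of_real_add)
    define r where "r = (norm a + norm b)\<^sup>2 / (norm a * norm b)"
    have "norm a + norm b > 0" using nz by (simp add: add_pos_pos)
    then have "r > 0" using nz by (simp add: r_def)
    moreover have "(cnj w * a + w * b)\<^sup>2 = of_real r * (a * b)"
    proof -
      have "a * b = of_real (norm a * norm b) * (sgn a * sgn b)"
        using arg_cong2[OF a b, of "(*)"] by (simp add: mult_ac)
      moreover have "(cnj w * a + w * b)\<^sup>2 = of_real ((norm a + norm b)\<^sup>2) * (sgn a * sgn b)"
        unfolding \<eta> power_mult_distrib[of "of_real (norm a + norm b)"] e2 by simp
      ultimately show ?thesis using nz by (simp only:) (simp add: r_def)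
    qed
    ultimately show "\<exists>r>0. (cnj w * a + w * b)\<^sup>2 = of_real r * (a * b)" by blast
  qed
qed

section \<open>Infinitesimal estimates along the flat disc\<close>

text \<open>What a holomorphic self-map of either domain does near a flat point, in the form needed for the
  estimates: composed with an embedding of the symmetrized bidisc, it takes a disc through the flat
  point over \<open>q\<close>, with transverse velocity \<open>\<alpha>\<close> and flat velocity \<open>\<beta>\<close>, to a disc in the tetrablock through the flat point over \<open>m\<close>, with velocity
  \<open>(\<alpha> y1, \<alpha> y2, \<alpha> x + \<beta> \<kappa>)\<close>. The numbers \<open>y1\<close>, \<open>y2\<close>, \<open>x\<close>, \<open>\<kappa>\<close> are thus made from entries of a Jacobian.\<close>

definition disc_transport :: "complex \<Rightarrow> complex \<Rightarrow> complex \<Rightarrow> complex \<Rightarrow> complex \<Rightarrow> complex \<Rightarrow> bool" where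
  "disc_transport q m y1 y2 x \<kappa> \<longleftrightarrow>
    (\<forall>s p \<alpha> \<beta>. s holomorphic_on ball 0 1 \<longrightarrow> p holomorphic_on ball 0 1 \<longrightarrow>
      (\<forall>t. norm t < 1 \<longrightarrow> (\<exists>z w. norm z < 1 \<and> norm w < 1 \<and> s t = z + w \<and> p t = z * w)) \<longrightarrow>
      s 0 = 0 \<longrightarrow> p 0 = q \<longrightarrow>
      (s has_field_derivative 2 * \<alpha>) (at 0) \<longrightarrow> (p has_field_derivative \<beta>) (at 0) \<longrightarrow>
      (\<exists>f1 f2 f3. f1 holomorphic_on ball 0 1 \<and> f2 holomorphic_on ball 0 1 \<and> f3 holomorphic_on ball 0 1 \<and>
        (\<forall>t. norm t < 1 \<longrightarrow> tetra (f1 t) (f2 t) (f3 t)) \<and> f1 0 = 0 \<and> f2 0 = 0 \<and> f3 0 = m \<and>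
        (f1 has_field_derivative \<alpha> * y1) (at 0) \<and> (f2 has_field_derivative \<alpha> * y2) (at 0) \<and>
        (f3 has_field_derivative \<alpha> * x + \<beta> * \<kappa>) (at 0)))"

lemma disc_transport_commute:
  assumes "disc_transport q m y1 y2 x \<kappa>" shows "disc_transport q m y2 y1 x \<kappa>"
  unfolding disc_transport_def
proof (intro allI impI)
  fix s p \<alpha> \<beta>
  assume "s holomorphic_on ball 0 1" "p holomorphic_on ball 0 1"
    "\<forall>t. norm t < 1 \<longrightarrow> (\<exists>z w. norm z < 1 \<and> norm w < 1 \<and> s t = z + w \<and> p t = z * w)"
    "s 0 = 0" "p 0 = q" "(s has_field_derivative 2 * \<alpha>) (at 0)" "(p has_field_derivative \<beta>) (at 0)"
  from assms[unfolded disc_transport_def, rule_format, OF this(1,2) _ this(4-), OF this(3)[rule_format]]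
  obtain f1 f2 f3 where
    "f1 holomorphic_on ball 0 1 \<and> f2 holomorphic_on ball 0 1 \<and> f3 holomorphic_on ball 0 1 \<and>
        (\<forall>t. norm t < 1 \<longrightarrow> tetra (f1 t) (f2 t) (f3 t)) \<and> f1 0 = 0 \<and> f2 0 = 0 \<and> f3 0 = m \<and>
        (f1 has_field_derivative \<alpha> * y1) (at 0) \<and> (f2 has_field_derivative \<alpha> * y2) (at 0) \<and>
        (f3 has_field_derivative \<alpha> * x + \<beta> * \<kappa>) (at 0)"
    by blast
  then show "\<exists>f1 f2 f3. f1 holomorphic_on ball 0 1 \<and> f2 holomorphic_on ball 0 1 \<and> f3 holomorphic_on ball 0 1 \<and>
        (\<forall>t. norm t < 1 \<longrightarrow> tetra (f1 t) (f2 t) (f3 t)) \<and> f1 0 = 0 \<and> f2 0 = 0 \<and> f3 0 = m \<and>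
        (f1 has_field_derivative \<alpha> * y2) (at 0) \<and> (f2 has_field_derivative \<alpha> * y1) (at 0) \<and>
        (f3 has_field_derivative \<alpha> * x + \<beta> * \<kappa>) (at 0)"
    using tetra_commute by (intro exI[of _ f2] exI[of _ f1] exI[of _ f3]) auto
qed

text \<open>The explicit discs of the symmetrized bidisc, transported, must obey \<open>tetra_disc_derivative_bound\<close>.\<close>

lemma disc_transport_bound:
  fixes C S :: real
  assumes T: "disc_transport q m y1 y2 x \<kappa>" and q: "norm q < 1" and \<rho>: "\<rho>\<^sup>2 = - q"
    and CS: "C\<^sup>2 + S\<^sup>2 = 1" and w: "norm w = 1"
  shows "norm (of_real C * (x - (cnj w * y1 - m * w * y2)) - 2 * \<i> * of_real S * (\<kappa> * \<rho>))
    \<le> (1 + norm m) * ((1 - norm m) / (1 - norm q))"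
proof -
  obtain s p where sp: "s holomorphic_on ball 0 1" "p holomorphic_on ball 0 1"
    "\<And>t. norm t < 1 \<Longrightarrow> \<exists>z w. norm z < 1 \<and> norm w < 1 \<and> s t = z + w \<and> p t = z * w"
    "s 0 = 0" "p 0 = q"
    "(s has_field_derivative 2 * of_real ((1 - norm q) * C)) (at 0)"
    "(p has_field_derivative of_real (1 - norm q) * (- 2 * \<i> * of_real S * \<rho>)) (at 0)"
    using symmetrized_bidisc_disc[OF q \<rho> CS] by metis
  from T[unfolded disc_transport_def, rule_format, OF sp(1,2) _ sp(4-), OF sp(3)]
  obtain f1 f2 f3 where f: "f1 holomorphic_on ball 0 1" "f2 holomorphic_on ball 0 1" "f3 holomorphic_on ball 0 1"
        "\<And>t. norm t < 1 \<Longrightarrow> tetra (f1 t) (f2 t) (f3 t)" "f1 0 = 0" "f2 0 = 0"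
        "(f1 has_field_derivative of_real ((1 - norm q) * C) * y1) (at 0)"
        "(f2 has_field_derivative of_real ((1 - norm q) * C) * y2) (at 0)"
        "(f3 has_field_derivative of_real ((1 - norm q) * C) * x + of_real (1 - norm q) * (- 2 * \<i> * of_real S * \<rho>) * \<kappa>) (at 0)"
        and f30: "f3 0 = m"
    by blast
  let ?v = "of_real C * (x - (cnj w * y1 - m * w * y2)) - 2 * \<i> * of_real S * (\<kappa> * \<rho>)"
  have "norm (of_real (1 - norm q) * ?v) \<le> 1 - (norm m)\<^sup>2"
    using tetra_disc_derivative_bound[OF f w] by (simp add: f30 algebra_simps)
  then have "(1 - norm q) * norm ?v \<le> 1 - (norm m)\<^sup>2"
    using q by (simp only: norm_mult norm_of_real abs_of_pos diff_gt_0_iff_gt)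
  moreover have "1 - (norm m)\<^sup>2 = (1 + norm m) * (1 - norm m)"
    by (simp add: power2_eq_square algebra_simps)
  ultimately show ?thesis using q by (simp add: pos_le_divide_eq mult.commute)
qed

text \<open>For \<open>S = 0\<close> the bound says that an ellipse with centre \<open>x\<close> lies in a disc about \<open>0\<close>. By central
  symmetry its major semi-axis \<open>norm y1 + norm m * norm y2\<close> is at most the radius. Exchanging \<open>y1\<close> and
  \<open>y2\<close> and adding gives the claim.\<close>

lemma disc_transport_norm_sum:
  assumes T: "disc_transport q m y1 y2 x \<kappa>" and q: "norm q < 1"
  shows "norm y1 + norm y2 \<le> 2 * ((1 - norm m) / (1 - norm q))"
proof -
  define c where "c = (1 - norm m) / (1 - norm q)"
  have half: "norm y1 + norm m * norm y2 \<le> (1 + norm m) * c" if T: "disc_transport q m y1 y2 x \<kappa>" for y1 y2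
  proof -
    obtain w where w: "norm w = 1" "norm (cnj w * y1 + w * (- m * y2)) = norm y1 + norm (- m * y2)"
      using align_phases[of y1 "- m * y2"] by metis
    define \<eta> where "\<eta> = cnj w * y1 + w * (- m * y2)"
    have rho: "(csqrt (-q))\<^sup>2 = - q" by simp
    have "norm (x - \<eta>) \<le> (1 + norm m) * c" "norm (x + \<eta>) \<le> (1 + norm m) * c"
      using disc_transport_bound[OF T q rho, of 1 0 w] disc_transport_bound[OF T q rho, of 1 0 "- w"] w
      by (simp_all add: \<eta>_def c_def algebra_simps)
    moreover have "norm (2 * \<eta>) \<le> norm (x + \<eta>) + norm (x - \<eta>)"
      using norm_triangle_ineq4[of "x + \<eta>" "x - \<eta>"] by simp
    ultimately have "norm \<eta> \<le> (1 + norm m) * c" by (simp add: norm_mult)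
    then show ?thesis using w(2) by (simp add: \<eta>_def norm_mult)
  qed
  have "(1 + norm m) * (norm y1 + norm y2) \<le> (1 + norm m) * (2 * c)"
    using half[OF T] half[OF disc_transport_commute[OF T]] by (simp add: algebra_simps)
  moreover have "1 + norm m > 0" by (simp add: add_pos_nonneg)
  ultimately have "norm y1 + norm y2 \<le> 2 * c" by (simp only: mult_le_cancel_left_pos)
  then show ?thesis by (simp only: c_def)
qed

lemma disc_transport_norm_prod:
  assumes T: "disc_transport q m y1 y2 x \<kappa>" and q: "norm q < 1"
  shows "norm (y1 * y2) \<le> ((1 - norm m) / (1 - norm q))\<^sup>2"
proof -
  define c where "c = (1 - norm m) / (1 - norm q)"
  have "4 * (norm y1 * norm y2) \<le> (norm y1 + norm y2)\<^sup>2"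
    using sum_squares_bound[of "norm y1" "norm y2"] by (simp add: power2_eq_square algebra_simps)
  also have "\<dots> \<le> (2 * c)\<^sup>2"
    using disc_transport_norm_sum[OF T q] by (intro power_mono) (simp_all add: c_def)
  finally have "norm (y1 * y2) \<le> c\<^sup>2" by (simp add: norm_mult power_mult_distrib)
  then show ?thesis by (simp only: c_def)
qed

lemma linear_le_square_imp_zero:
  fixes R M :: real assumes "\<And>\<tau>. \<tau> * R \<le> M * \<tau>\<^sup>2" shows "R = 0"
proof (rule ccontr)
  assume "R \<noteq> 0"
  define N where "N = \<bar>M\<bar> + 1"
  have N: "N > 0" "M < N" by (auto simp: N_def)
  have "R\<^sup>2 * N \<le> M * R\<^sup>2"
    using assms[of "R / N"] N by (simp add: power2_eq_square field_simps)
  then have "R\<^sup>2 * (N - M) \<le> 0" by (simp add: algebra_simps)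
  then show False using N \<open>R \<noteq> 0\<close> by (simp add: mult_le_0_iff)
qed

text \<open>Where the ellipse reaches the bounding circle, the centre \<open>x\<close> must vanish and the discs with \<open>S \<noteq> 0\<close>
  become tests to first order: \<open>S\<close> changes \<open>C\<close> only to second order, so the velocity \<open>2 i \<kappa> \<rho>\<close> must be
  orthogonal to the extremal vector.\<close>

lemma disc_transport_extremal_orthogonal:
  assumes T: "disc_transport q m y1 y2 x \<kappa>" and q: "norm q < 1" and \<rho>: "\<rho>\<^sup>2 = - q" and w: "norm w = 1"
    and ext: "norm (cnj w * y1 - m * w * y2) = (1 + norm m) * ((1 - norm m) / (1 - norm q))"
  shows "Im (\<kappa> * \<rho> * cnj (cnj w * y1 - m * w * y2)) = 0"
proof -
  define \<eta> where "\<eta> = cnj w * y1 - m * w * y2"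
  define K where "K = (1 + norm m) * ((1 - norm m) / (1 - norm q))"
  have \<eta>K: "norm \<eta> = K" using ext by (simp add: \<eta>_def K_def)
  note B = disc_transport_bound[OF T q \<rho>, folded K_def]
  have "norm (x - \<eta>) \<le> K" "norm (x + \<eta>) \<le> K"
    using B[of 1 0 w] B[of 1 0 "- w"] w by (simp_all add: \<eta>_def algebra_simps)
  then have "(norm (x - \<eta>))\<^sup>2 + (norm (x + \<eta>))\<^sup>2 \<le> K\<^sup>2 + K\<^sup>2"
    by (intro add_mono power_mono) auto
  moreover have "(norm (x - \<eta>))\<^sup>2 + (norm (x + \<eta>))\<^sup>2 = 2 * (norm x)\<^sup>2 + 2 * (norm \<eta>)\<^sup>2"
    by (simp only: cmod_power2) (simp add: power2_eq_square algebra_simps)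
  ultimately have x0: "x = 0" using \<eta>K by simp
  define u where "u = 2 * \<i> * (\<kappa> * \<rho>)"
  have ineq: "2 * \<tau> * Re (u * cnj \<eta>) \<le> (K\<^sup>2 - (norm u)\<^sup>2) * \<tau>\<^sup>2" for \<tau> :: real
  proof -
    \<comment> \<open>normalizes \<open>(1, \<tau>)\<close> to \<open>(C, S)\<close>\<close>
    define n where "n = sqrt (1 + \<tau>\<^sup>2)"
    have n: "n > 0" "n\<^sup>2 = 1 + \<tau>\<^sup>2" by (simp_all add: n_def add_pos_nonneg)
    have "(1 / n)\<^sup>2 + (\<tau> / n)\<^sup>2 = (1 + \<tau>\<^sup>2) / n\<^sup>2"
      by (simp add: power_divide add_divide_distrib)
    also have "\<dots> = 1" using n by (metis divide_self less_irrefl zero_eq_power2)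
    finally have "(1 / n)\<^sup>2 + (\<tau> / n)\<^sup>2 = 1" .
    from B[OF this w, folded \<eta>_def, unfolded x0]
    have "norm (of_real (1 / n) * (0 - \<eta>) - of_real (\<tau> / n) * u) \<le> K"
      by (simp only: u_def mult_ac)
    moreover have "of_real (1 / n) * (0 - \<eta>) - of_real (\<tau> / n) * u = - ((\<eta> + of_real \<tau> * u) / of_real n)"
      by (simp add: add_divide_distrib)
    ultimately have "norm (\<eta> + of_real \<tau> * u) / n \<le> K"
      using n by (simp add: norm_divide)
    then have "norm (\<eta> + of_real \<tau> * u) \<le> K * n" using n by (simp add: field_simps)
    then have "(norm (\<eta> + of_real \<tau> * u))\<^sup>2 \<le> (K * n)\<^sup>2" by (simp add: power_mono)
    also have "\<dots> = K\<^sup>2 * (1 + \<tau>\<^sup>2)" by (simp add: power_mult_distrib n)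
    finally have "(norm (\<eta> + of_real \<tau> * u))\<^sup>2 \<le> K\<^sup>2 * (1 + \<tau>\<^sup>2)" .
    moreover have "(norm (\<eta> + of_real \<tau> * u))\<^sup>2 = (norm \<eta>)\<^sup>2 + 2 * \<tau> * Re (u * cnj \<eta>) + \<tau>\<^sup>2 * (norm u)\<^sup>2"
      by (simp only: cmod_power2) (simp add: power2_eq_square algebra_simps)
    ultimately show ?thesis by (simp add: \<eta>K algebra_simps)
  qed
  have "2 * Re (u * cnj \<eta>) = 0"
    by (rule linear_le_square_imp_zero[of _ "K\<^sup>2 - (norm u)\<^sup>2"]) (use ineq in \<open>simp add: mult_ac\<close>)
  moreover have "u * cnj \<eta> = \<i> * (2 * (\<kappa> * \<rho> * cnj \<eta>))" by (simp add: u_def)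
  moreover have "Re (\<i> * (2 * X)) = - 2 * Im X" for X by simp
  ultimately have "Im (\<kappa> * \<rho> * cnj \<eta>) = 0" by (simp only:)
  then show ?thesis by (simp only: \<eta>_def)
qed

text \<open>Equality in \<open>disc_transport_norm_prod\<close> makes the preceding orthogonality available. If \<open>m = 0\<close>, the
  ellipse is a circle, every direction is extremal and \<open>2 i \<kappa> \<rho>\<close> would be orthogonal to all of them. Otherwise
  the major axis of the ellipse has square direction \<open>- m y1 y2\<close>, and \<open>\<kappa> \<rho>\<close> with \<open>\<rho>\<^sup>2 = - q\<close> is a real
  multiple of it.\<close>

lemma disc_transport_extremal:
  assumes T: "disc_transport q m y1 y2 x \<kappa>" and q: "norm q < 1" "q \<noteq> 0" and m: "norm m < 1"
    and \<kappa>: "\<kappa> \<noteq> 0" and ext: "norm (y1 * y2) \<ge> ((1 - norm m) / (1 - norm q))\<^sup>2"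
  shows "m \<noteq> 0 \<and> (\<exists>r>0. \<kappa>\<^sup>2 * q = of_real r * (m * (y1 * y2)))"
proof -
  define c where "c = (1 - norm m) / (1 - norm q)"
  have c: "c > 0" using q m by (simp add: c_def)
  have sum: "norm y1 + norm y2 \<le> 2 * c" using disc_transport_norm_sum[OF T q(1)] by (simp add: c_def)
  have "(norm y1 - norm y2)\<^sup>2 = (norm y1 + norm y2)\<^sup>2 - 4 * (norm y1 * norm y2)"
    by (simp add: power2_eq_square algebra_simps)
  also have "\<dots> \<le> (2 * c)\<^sup>2 - 4 * c\<^sup>2"
    using sum ext by (intro diff_mono power_mono) (auto simp: c_def norm_mult)
  finally have eq: "norm y1 = norm y2" by (simp add: power_mult_distrib)
  have "c\<^sup>2 \<le> (norm y1)\<^sup>2" using ext eq by (simp add: c_def norm_mult power2_eq_square)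
  then have "c \<le> norm y1" by (rule power2_le_imp_le) simp
  then have ny: "norm y1 = c" "norm y2 = c" using sum eq by linarith+
  define \<rho> where "\<rho> = csqrt (- q)"
  have \<rho>: "\<rho>\<^sup>2 = - q" by (simp add: \<rho>_def)
  then have \<kappa>\<rho>: "\<kappa> * \<rho> \<noteq> 0" using \<kappa> q by auto
  have orth: "Im (\<kappa> * \<rho> * cnj (cnj w * y1 - m * w * y2)) = 0"
    if "norm w = 1" "norm (cnj w * y1 - m * w * y2) = (1 + norm m) * c" for w
    using disc_transport_extremal_orthogonal[OF T q(1) \<rho> that(1)] that(2) by (simp add: c_def)
  have m0: "m \<noteq> 0"
  proof
    assume "m = 0"
    then have "Im (\<kappa> * \<rho> * cnj y1) = 0" "Im (\<kappa> * \<rho> * (\<i> * cnj y1)) = 0"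
      using orth[of 1] orth[of \<i>] ny by (simp_all add: norm_mult)
    then have "\<kappa> * \<rho> * cnj y1 = 0" by (simp add: complex_eq_iff algebra_simps)
    then show False using \<kappa>\<rho> ny c by auto
  qed
  have nz: "y1 \<noteq> 0" "- m * y2 \<noteq> 0" using ny c m0 by auto
  obtain w r where w: "norm w = 1" "norm (cnj w * y1 + w * (- m * y2)) = norm y1 + norm (- m * y2)"
    and r: "r > 0" "(cnj w * y1 + w * (- m * y2))\<^sup>2 = of_real r * (y1 * (- m * y2))"
    using align_phases[of y1 "- m * y2"] nz by metis
  define \<eta> where "\<eta> = cnj w * y1 - m * w * y2"
  have \<eta>: "\<eta> = cnj w * y1 + w * (- m * y2)" by (simp add: \<eta>_def)
  have n\<eta>: "norm \<eta> = (1 + norm m) * c" unfolding \<eta> w(2) by (simp add: norm_mult ny algebra_simps)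
  then have \<eta>0: "\<eta> \<noteq> 0" using c by (metis add_pos_nonneg mult_pos_pos norm_ge_zero norm_zero less_irrefl zero_less_one)
  define k where "k = Re (\<kappa> * \<rho> * cnj \<eta>)"
  have k: "\<kappa> * \<rho> * cnj \<eta> = of_real k"
    using orth[OF w(1)] n\<eta> by (simp add: k_def \<eta>_def complex_eq_iff)
  have k0: "k \<noteq> 0" using k \<kappa>\<rho> \<eta>0 by (metis complex_cnj_zero_iff mult_eq_0_iff of_real_0)
  have nn: "cnj \<eta> * \<eta> = of_real ((norm \<eta>)\<^sup>2)" using complex_norm_square[of \<eta>] by (simp add: mult.commute)
  have "(\<kappa> * \<rho>)\<^sup>2 * (of_real ((norm \<eta>)\<^sup>2))\<^sup>2 = (\<kappa> * \<rho> * cnj \<eta>)\<^sup>2 * \<eta>\<^sup>2"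
    by (simp add: nn[symmetric] power_mult_distrib mult_ac del: of_real_power)
  also have "\<dots> = of_real (k\<^sup>2) * (of_real r * (y1 * (- m * y2)))"
    unfolding k using r(2) by (simp add: \<eta>)
  finally have e: "\<kappa>\<^sup>2 * q * of_real ((norm \<eta>) ^ 4) = of_real (k\<^sup>2 * r) * (m * (y1 * y2))"
    by (simp add: power_mult_distrib \<rho> mult_ac flip: power_mult)
  have "\<kappa>\<^sup>2 * q = of_real (k\<^sup>2 * r / (norm \<eta>) ^ 4) * (m * (y1 * y2))"
    using e \<eta>0 by (simp add: field_simps)
  moreover have "k\<^sup>2 * r / (norm \<eta>) ^ 4 > 0" using k0 r(1) \<eta>0 by simp
  ultimately show ?thesis using m0 by blast
qed

text \<open>The contradiction, common to both domains. \<open>D q\<close> measures the transverse Jacobian over \<open>q\<close>. It is at most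
  \<open>(c q)\<^sup>2\<close> with \<open>c q = (1 - norm (m q)) / (1 - norm q)\<close>, and both quantities are inverted by \<open>m\<close>, so
  equality holds everywhere and \<open>disc_transport_extremal\<close> applies. If \<open>m 0 \<noteq> 0\<close>, it fails at \<open>m 0\<close>, which \<open>m\<close>
  sends to \<open>0\<close>. If \<open>m 0 = 0\<close>, it makes \<open>y1 * y2\<close> negative at every \<open>q \<noteq> 0\<close>, against the assumption on the
  behaviour near \<open>0\<close>.\<close>

lemma no_flat_symmetry:
  fixes D :: "complex \<Rightarrow> real" and y1 y2 x :: "complex \<Rightarrow> complex \<Rightarrow> complex" and \<kappa> m :: "complex \<Rightarrow> complex"
  assumes m: "\<And>q. norm q < 1 \<Longrightarrow> norm (m q) < 1" "\<And>q. norm q < 1 \<Longrightarrow> m (m q) = q"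
    and T: "\<And>q \<sigma>. norm q < 1 \<Longrightarrow> norm \<sigma> = 1 \<Longrightarrow> disc_transport q (m q) (y1 q \<sigma>) (y2 q \<sigma>) (x q \<sigma>) (\<kappa> q)"
    and D: "\<And>q. norm q < 1 \<Longrightarrow> D q * D (m q) = 1"
      "\<And>q. norm q < 1 \<Longrightarrow> D q \<ge> 0"
      "\<And>q. norm q < 1 \<Longrightarrow> \<exists>\<sigma>. norm \<sigma> = 1 \<and> D q \<le> norm (y1 q \<sigma> * y2 q \<sigma>)"
    and \<kappa>: "\<And>q. norm q < 1 \<Longrightarrow> \<kappa> q \<noteq> 0"
    and centre: "m 0 = 0 \<Longrightarrow> (\<forall>q. norm q < 1 \<longrightarrow> m q = - q \<and> \<kappa> q = -1) \<and>
      (\<exists>e>0. \<forall>q \<sigma>. norm q < e \<longrightarrow> norm \<sigma> = 1 \<longrightarrow> Re (y1 q \<sigma> * y2 q \<sigma>) > 0)"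
  shows False
proof -
  define c where "c q = (1 - norm (m q)) / (1 - norm q)" for q
  have c: "c q > 0" "c (m q) = 1 / c q" if "norm q < 1" for q
    using m(1)[OF that] that by (simp_all add: c_def m(2)[OF that])
  have Dle: "D q \<le> (c q)\<^sup>2" if q: "norm q < 1" for q
  proof -
    obtain \<sigma> where "norm \<sigma> = 1" "D q \<le> norm (y1 q \<sigma> * y2 q \<sigma>)" using D(3)[OF q] by blast
    then show ?thesis using disc_transport_norm_prod[OF T[OF q] q] by (fastforce simp: c_def)
  qed
  have Dge: "(c q)\<^sup>2 \<le> D q" if q: "norm q < 1" for q
  proof -
    have "D q * D (m q) \<le> D q * (c (m q))\<^sup>2"
      using Dle[OF m(1)[OF q]] D(2)[OF q] by (rule mult_left_mono)
    then have "1 \<le> D q / (c q)\<^sup>2" using D(1)[OF q] c[OF q] by (simp add: power_divide)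
    then show ?thesis using c[OF q] by (simp add: field_simps)
  qed
  have key: "m q \<noteq> 0 \<and> (\<exists>\<sigma> r. norm \<sigma> = 1 \<and> r > 0 \<and> (\<kappa> q)\<^sup>2 * q = of_real r * (m q * (y1 q \<sigma> * y2 q \<sigma>)))"
    if q: "norm q < 1" "q \<noteq> 0" for q
  proof -
    obtain \<sigma> where \<sigma>: "norm \<sigma> = 1" "D q \<le> norm (y1 q \<sigma> * y2 q \<sigma>)" using D(3)[OF q(1)] by blast
    have "norm (y1 q \<sigma> * y2 q \<sigma>) \<ge> ((1 - norm (m q)) / (1 - norm q))\<^sup>2"
      using Dge[OF q(1)] \<sigma>(2) by (simp add: c_def)
    from disc_transport_extremal[OF T[OF q(1) \<sigma>(1)] q m(1)[OF q(1)] \<kappa>[OF q(1)] this]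
    show ?thesis using \<sigma>(1) by blast
  qed
  show False
  proof (cases "m 0 = 0")
    case False
    then show False using key[of "m 0"] m(1)[of 0] m(2)[of 0] by simp
  next
    case True
    then obtain e where e: "e > 0" "\<And>q \<sigma>. norm q < e \<Longrightarrow> norm \<sigma> = 1 \<Longrightarrow> Re (y1 q \<sigma> * y2 q \<sigma>) > 0"
      and neg: "\<And>q. norm q < 1 \<Longrightarrow> m q = - q \<and> \<kappa> q = -1"
      using centre by blast
    define q :: complex where "q = of_real (min e 1 / 2)"
    have q: "norm q < 1" "norm q < e" "q \<noteq> 0" using e(1) by (auto simp: q_def)
    obtain \<sigma> r where \<sigma>: "norm \<sigma> = 1" "r > 0" "(\<kappa> q)\<^sup>2 * q = of_real r * (m q * (y1 q \<sigma> * y2 q \<sigma>))"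
      using key[OF q(1,3)] by blast
    then have "q * (of_real r * (y1 q \<sigma> * y2 q \<sigma>) + 1) = 0"
      using neg[OF q(1)] by (simp add: algebra_simps add_eq_0_iff2)
    then have "of_real r * (y1 q \<sigma> * y2 q \<sigma>) + 1 = 0" using q(3) by (metis mult_eq_0_iff)
    then have "Re (of_real r * (y1 q \<sigma> * y2 q \<sigma>) + 1) = 0" by (simp only: zero_complex.simps)
    then have "r * Re (y1 q \<sigma> * y2 q \<sigma>) = -1"
      by (simp only: plus_complex.simps one_complex.simps) simp
    then show False using e(2)[OF q(2) \<sigma>(1)] \<sigma>(2) mult_pos_pos[of r "Re (y1 q \<sigma> * y2 q \<sigma>)"] by linarith
  qed
qed

section \<open>Moving a point of symmetry to the flat disc\<close>

lemma vector_3_eta: "vector [x $ 1, x $ 2, x $ 3] = (x :: complex^3)"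
  by (simp add: vec_eq_iff forall_3)

text \<open>A point \<open>x\<close> of the tetrablock encodes the linear fractional map \<open>z \<mapsto> (x\<^sub>3 z - x\<^sub>1) / (x\<^sub>2 z - 1)\<close>; this
  is the action of composing it with the Moebius function that sends \<open>a\<close> to \<open>0\<close>.\<close>

definition tetrablock_move :: "complex \<Rightarrow> complex^3 \<Rightarrow> complex^3" where
  "tetrablock_move a x = vector [(x$1 - a) / (1 - cnj a * x$1),
     (x$2 - cnj a * x$3) / (1 - cnj a * x$1), (x$3 - a * x$2) / (1 - cnj a * x$1)]"

definition tetrablock_flip :: "complex^3 \<Rightarrow> complex^3" where
  "tetrablock_flip x = vector [x$2, x$1, x$3]"

text \<open>Substituting the Moebius image \<open>z'\<close> for \<open>z\<close> turns the condition for the moved point into the condition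
  for the original one, up to a nonvanishing factor.\<close>

lemma tetra_move:
  assumes T: "tetra x y p" and a: "norm a < 1"
  shows "tetra ((x - a) / (1 - cnj a * x)) ((y - cnj a * p) / (1 - cnj a * x)) ((p - a * y) / (1 - cnj a * x))"
  unfolding tetra_def
proof (intro allI impI)
  fix z w :: complex assume zw: "norm z \<le> 1 \<and> norm w \<le> 1"
  define d where "d = 1 - cnj a * x"
  have d: "d \<noteq> 0" unfolding d_def by (rule mob_denominator_nonzero[OF a tetra_norm_less_1[OF T]])
  have "norm (a * z) < 1" using a zw mult_left_le[of "norm z" "norm a"] by (simp add: norm_mult)
  then have az: "1 + a * z \<noteq> 0" by (metis add_eq_0_iff less_irrefl norm_minus_cancel norm_one)
  \<comment> \<open>the Moebius image that is substituted for \<open>z\<close>\<close>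
  define z' where "z' = (z + cnj a) / (1 + a * z)"
  have z'eq: "z' * (1 + a * z) = z + cnj a" using az by (simp add: z'_def)
  have "norm z' \<le> 1"
  proof -
    have "(norm (1 + a * z))\<^sup>2 - (norm (z + cnj a))\<^sup>2 = (1 - (norm a)\<^sup>2) * (1 - (norm z)\<^sup>2)"
      by (simp only: cmod_power2) (simp add: power2_eq_square algebra_simps)
    moreover have "\<dots> \<ge> 0" using a zw by (intro mult_nonneg_nonneg) (simp_all add: power_le_one)
    ultimately have "(norm (z + cnj a))\<^sup>2 \<le> (norm (1 + a * z))\<^sup>2" by linarith
    then have "norm (z + cnj a) \<le> norm (1 + a * z)" by (rule power2_le_imp_le) simp
    then show ?thesis using az by (simp add: z'_def norm_divide)
  qed
  then have "1 - x * z' - y * w + p * z' * w \<noteq> 0" using T zw unfolding tetra_def by blast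
  moreover have "d * (1 - (x - a) / d * z - (y - cnj a * p) / d * w + (p - a * y) / d * z * w)
      = (1 + a * z) * (1 - x * z' - y * w + p * z' * w)"
  proof -
    have "d * (1 - (x - a) / d * z - (y - cnj a * p) / d * w + (p - a * y) / d * z * w)
        = d - (x - a) * z - (y - cnj a * p) * w + (p - a * y) * z * w"
    proof -
      have "d * (1 - X * z - Y * w + Z * z * w) = d - d * X * z - d * Y * w + d * Z * z * w" for X Y Z
        by (simp add: algebra_simps)
      from this[of "(x - a) / d" "(y - cnj a * p) / d" "(p - a * y) / d"]
      show ?thesis unfolding times_divide_eq_right nonzero_mult_div_cancel_left[OF d] .
    qed
    also have "\<dots> = (1 + a * z) - x * (z' * (1 + a * z)) - y * w * (1 + a * z) + p * w * (z' * (1 + a * z))"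
      unfolding z'eq d_def by (simp add: algebra_simps)
    finally show ?thesis by (simp add: algebra_simps)
  qed
  ultimately show "1 - (x - a) / (1 - cnj a * x) * z - (y - cnj a * p) / (1 - cnj a * x) * w
      + (p - a * y) / (1 - cnj a * x) * z * w \<noteq> 0"
    using az unfolding d_def by (metis mult_eq_0_iff)
qed

lemma tetrablock_move_mem:
  assumes "x \<in> tetrablock" "norm a < 1" shows "tetrablock_move a x \<in> tetrablock"
  using tetra_move assms by (simp add: mem_tetrablock_iff tetrablock_move_def)

lemma tetrablock_move_inverse:
  assumes "x \<in> tetrablock" "norm a < 1" shows "tetrablock_move (- a) (tetrablock_move a x) = x"
proof -
  define d where "d = 1 - cnj a * x$1"
  have x1: "norm (x$1) < 1" using assms(1) tetra_norm_less_1 by (auto simp: mem_tetrablock_iff)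
  have d: "d \<noteq> 0" unfolding d_def by (rule mob_denominator_nonzero[OF assms(2) x1])
  define k where "k = 1 - cnj a * a"
  have k: "k \<noteq> 0" unfolding k_def by (rule mob_denominator_nonzero[OF assms(2) assms(2)])
  have e: "1 + cnj a * (x$1 - a) / d = k / d"
    using d by (simp add: d_def k_def field_simps)
  have "((x$1 - a) / d + a) / (k / d) = x$1"
  proof -
    have "(x$1 - a) / d + a = (k * x$1) / d" using d by (simp add: field_simps) (simp add: d_def k_def algebra_simps)
    then show ?thesis using d k by simp
  qed
  moreover have "((x$2 - cnj a * x$3) / d + cnj a * ((x$3 - a * x$2) / d)) / (k / d) = x$2"
  proof -
    have "(x$2 - cnj a * x$3) / d + cnj a * ((x$3 - a * x$2) / d) = (k * x$2) / d"
      by (simp add: k_def algebra_simps flip: add_divide_distrib)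
    then show ?thesis using d k by simp
  qed
  moreover have "((x$3 - a * x$2) / d + a * ((x$2 - cnj a * x$3) / d)) / (k / d) = x$3"
  proof -
    have "(x$3 - a * x$2) / d + a * ((x$2 - cnj a * x$3) / d) = (k * x$3) / d"
      by (simp add: k_def algebra_simps flip: add_divide_distrib)
    then show ?thesis using d k by simp
  qed
  ultimately show ?thesis
    by (simp add: tetrablock_move_def e vec_eq_iff forall_3 flip: d_def)
qed

lemma tetrablock_move_holomorphic:
  assumes "norm a < 1" shows "holomorphic_map_on (tetrablock_move a) tetrablock"
proof (rule holomorphic_map_onI)
  fix x :: "complex^3" and i :: 3 assume "x \<in> tetrablock"
  then have "norm (x$1) < 1" using tetra_norm_less_1 by (auto simp: mem_tetrablock_iff)
  then have d: "1 - cnj a * x$1 \<noteq> 0" by (rule mob_denominator_nonzero[OF assms])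
  have "\<forall>i. complex_linear_derivative_at (\<lambda>x. tetrablock_move a x $ i) x"
    unfolding forall_3 tetrablock_move_def vector_3
    by (intro conjI complex_linear_derivative_at_intros d)
  then show "complex_linear_derivative_at (\<lambda>x. tetrablock_move a x $ i) x" by blast
qed

lemma point_of_symmetry_move:
  assumes "point_of_symmetry tetrablock l" "norm a < 1"
  shows "point_of_symmetry tetrablock (tetrablock_move a l)"
  by (rule point_of_symmetry_automorphism[OF assms(1), where g = "tetrablock_move (- a)"])
    (use assms(2) tetrablock_move_holomorphic tetrablock_move_mem tetrablock_move_inverse[of _ a]
      tetrablock_move_inverse[of _ "- a"] in auto)

lemma point_of_symmetry_flip:
  assumes "point_of_symmetry tetrablock l"
  shows "point_of_symmetry tetrablock (tetrablock_flip l)"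
proof (rule point_of_symmetry_automorphism[OF assms, where g = tetrablock_flip])
  show hol: "holomorphic_map_on tetrablock_flip tetrablock"
  proof (rule holomorphic_map_onI)
    fix x :: "complex^3" and i :: 3
    have "\<forall>i. complex_linear_derivative_at (\<lambda>x. tetrablock_flip x $ i) x"
      unfolding forall_3 tetrablock_flip_def vector_3 by (intro conjI complex_linear_derivative_at_intros)
    then show "complex_linear_derivative_at (\<lambda>x. tetrablock_flip x $ i) x" by blast
  qed
  show "holomorphic_map_on tetrablock_flip tetrablock" by (rule hol)
  show "tetrablock_flip ` tetrablock \<subseteq> tetrablock"
    using tetra_commute by (auto simp: tetrablock_flip_def mem_tetrablock_iff)
  then show "tetrablock_flip ` tetrablock \<subseteq> tetrablock" .
qed (simp_all add: tetrablock_flip_def vector_3_eta)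

text \<open>With \<open>a = - w t\<close> and \<open>t\<close> real the equation becomes \<open>(norm w)\<^sup>2 t\<^sup>2 - K t + 1 = 0\<close>, and the smaller
  solution \<open>t\<close> gives a root in the disc.\<close>

lemma hermitian_quadratic_root:
  fixes w :: complex and K :: real
  assumes "K > 2 * norm w"
  obtains a where "norm a < 1" "cnj w * a\<^sup>2 + of_real K * a + w = 0"
proof -
  have K: "K > 0" using assms norm_ge_zero[of w] by linarith
  have "(2 * norm w)\<^sup>2 \<le> K\<^sup>2" using assms by (intro power_mono) auto
  then have disc: "K\<^sup>2 - 4 * (norm w)\<^sup>2 \<ge> 0" by (simp add: power_mult_distrib)
  define R where "R = sqrt (K\<^sup>2 - 4 * (norm w)\<^sup>2)"
  have R: "R \<ge> 0" "R\<^sup>2 = K\<^sup>2 - 4 * (norm w)\<^sup>2" using disc by (simp_all add: R_def)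
  \<comment> \<open>the smaller root of \<open>(norm w)\<^sup>2 t\<^sup>2 - K t + 1\<close>, written without cancellation\<close>
  define t where "t = 2 / (K + R)"
  have KR: "K + R > 0" using K R by linarith
  then have t: "t > 0" "t * (K + R) = 2"
    by (simp add: t_def) (metis KR less_irrefl nonzero_eq_divide_eq t_def)
  have "t * K \<le> 2" using t(2) mult_nonneg_nonneg[OF less_imp_le[OF t(1)] R(1)] by (simp add: distrib_left)
  then have "t * (2 * norm w) < 2" using mult_strict_left_mono[OF assms t(1)] by linarith
  have q: "(norm w)\<^sup>2 * t\<^sup>2 - K * t + 1 = 0"
  proof -
    have "4 * ((norm w)\<^sup>2 * t\<^sup>2 - K * t + 1) = (K\<^sup>2 - R\<^sup>2) * t\<^sup>2 - 4 * K * t + 4"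
      by (simp only: R(2)) (simp add: algebra_simps)
    also have "\<dots> = (t * (K + R)) * (t * K - t * R) - 4 * K * t + 4"
      by (simp add: power2_eq_square algebra_simps)
    also have "\<dots> = 0" unfolding t(2) using t(2) by (simp add: algebra_simps)
    finally have "4 * ((norm w)\<^sup>2 * t\<^sup>2 - K * t + 1) = 0" .
    then show ?thesis by simp
  qed
  show ?thesis
  proof
    show "norm (- w * of_real t) < 1" using \<open>t * (2 * norm w) < 2\<close> t(1) by (simp add: norm_mult mult.commute)
    have "cnj w * (- w * of_real t)\<^sup>2 + of_real K * (- w * of_real t) + w
       = w * ((w * cnj w) * (of_real t)\<^sup>2 - of_real K * of_real t + 1)"
      by (simp add: power2_eq_square algebra_simps)
    also have "\<dots> = w * of_real ((norm w)\<^sup>2 * t\<^sup>2 - K * t + 1)"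
      using complex_norm_square[of w] by simp
    finally show "cnj w * (- w * of_real t)\<^sup>2 + of_real K * (- w * of_real t) + w = 0" by (simp add: q)
  qed
qed

text \<open>Every orbit of the automorphism group meets the flat disc. The first move kills \<open>x\<^sub>1\<close>. For a point
  \<open>(0, y, p)\<close>, a move by \<open>a\<close> on one side and then by \<open>b = y - cnj a * p\<close> on the other kills both of the first
  two coordinates exactly when \<open>a\<close> solves a quadratic equation that has a root in the disc, because
  \<open>norm y + norm p < 1\<close>.\<close>

lemma tetrablock_symmetry_at_flat_point:
  assumes l: "point_of_symmetry tetrablock l"
  obtains a where "norm a < 1" "point_of_symmetry tetrablock (vector [0, 0, a])"
proof -
  have mem: "l \<in> tetrablock" if "point_of_symmetry tetrablock l" for l
    using that unfolding point_of_symmetry_def isolated_in_def by auto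
  have l1: "norm (l$1) < 1" using mem[OF l] tetra_norm_less_1 by (auto simp: mem_tetrablock_iff)
  define l' where "l' = tetrablock_move (l$1) l"
  define y p where "y = l'$2" and "p = l'$3"
  have l': "l' = vector [0, y, p]" unfolding y_def p_def
    using vector_3_eta[of l'] by (simp add: l'_def tetrablock_move_def)
  have sym': "point_of_symmetry tetrablock l'" unfolding l'_def by (rule point_of_symmetry_move[OF l l1])
  then have T: "tetra 0 y p" using mem[OF sym'] by (simp add: mem_tetrablock_iff l')
  obtain w where w: "norm w = 1" "norm (cnj w * (- y) + w * p) = norm (- y) + norm p"
    using align_phases[of "- y" p] by metis
  have "norm (p * w\<^sup>2 - y) < 1"
    using tetra_Psi(2)[of y 0 p "w\<^sup>2"] T tetra_commute w(1) by (simp add: norm_power norm_minus_commute)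
  moreover have "w * cnj w = 1" using w(1) complex_norm_square[of w] by simp
  then have "p * w\<^sup>2 - y = w * (cnj w * (- y) + w * p)" by (simp add: power2_eq_square algebra_simps)
  ultimately have yp: "norm y + norm p < 1" using w by (simp add: norm_mult)
  then have "(norm y + norm p)\<^sup>2 < 1" by (simp add: power_less_one_iff)
  then have "1 - (norm y)\<^sup>2 - (norm p)\<^sup>2 > 2 * norm (cnj y * p)"
    by (simp add: norm_mult power2_eq_square algebra_simps)
  then obtain a where a: "norm a < 1"
    and root: "cnj (cnj y * p) * a\<^sup>2 + of_real (1 - (norm y)\<^sup>2 - (norm p)\<^sup>2) * a + cnj y * p = 0"
    by (rule hermitian_quadratic_root)
  \<comment> \<open>second coordinate after the move by \<open>a\<close>\<close>
  define b where "b = y - cnj a * p"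
  have eq: "a + cnj b * (p - a * y) = 0"
  proof -
    have "a + cnj b * (p - a * y) = cnj (cnj y * p) * a\<^sup>2 + (1 - y * cnj y - p * cnj p) * a + cnj y * p"
      by (simp add: b_def power2_eq_square algebra_simps)
    then show ?thesis using root complex_norm_square[of y] complex_norm_square[of p] by simp
  qed
  define l'' where "l'' = tetrablock_flip (tetrablock_move a l')"
  have sym'': "point_of_symmetry tetrablock l''" unfolding l''_def
    by (intro point_of_symmetry_flip point_of_symmetry_move sym' a)
  have l'': "l'' = vector [b, - a, p - a * y]"
    by (simp add: l''_def tetrablock_flip_def tetrablock_move_def l' b_def)
  have b: "norm b < 1" using mem[OF sym''] tetra_norm_less_1 by (auto simp: mem_tetrablock_iff l'')
  define c where "c = (p - a * y - b * - a) / (1 - cnj b * b)"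
  have eq0: "- a - cnj b * (p - a * y) = 0" using eq by algebra
  have "tetrablock_move b l'' = vector [0, 0, c]"
    by (simp only: tetrablock_move_def l'' vector_3 eq0 c_def diff_self div_0)
  then have sym: "point_of_symmetry tetrablock (vector [0, 0, c])"
    using point_of_symmetry_move[OF sym'' b] by simp
  have "tetra 0 0 c" using mem[OF sym] by (simp add: mem_tetrablock_iff)
  then have "norm c < 1" using tetra_Psi(2)[of 0 0 c 1] by simp
  then show ?thesis using sym that by blast
qed

text \<open>The automorphism of the symmetrized bidisc induced by the Moebius function of \<open>a\<close> on both factors,
  written in the coordinates \<open>s = z + w\<close> and \<open>p = z w\<close>.\<close>

definition symmetrized_mob :: "complex \<Rightarrow> complex^2 \<Rightarrow> complex^2" where
  "symmetrized_mob a x = vector [((1 + a * cnj a) * x$1 - 2 * a - 2 * cnj a * x$2) / (1 - cnj a * x$1 + (cnj a)\<^sup>2 * x$2),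
     (x$2 - a * x$1 + a\<^sup>2) / (1 - cnj a * x$1 + (cnj a)\<^sup>2 * x$2)]"

lemma symmetrized_mob_denominator:
  assumes "norm a < 1" "norm z < 1" "norm w < 1"
  shows "1 - cnj a * (z + w) + (cnj a)\<^sup>2 * (z * w) \<noteq> 0"
proof -
  have "1 - cnj a * (z + w) + (cnj a)\<^sup>2 * (z * w) = (1 - cnj a * z) * (1 - cnj a * w)"
    by (simp add: power2_eq_square algebra_simps)
  then show ?thesis using mob_denominator_nonzero assms by simp
qed

lemma symmetrized_mob_eq:
  assumes a: "norm a < 1" and z: "norm z < 1" and w: "norm w < 1"
  shows "symmetrized_mob a (vector [z + w, z * w]) = vector [mob a z + mob a w, mob a z * mob a w]"
proof -
  define dz dw where "dz = 1 - cnj a * z" and "dw = 1 - cnj a * w"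
  have d: "dz \<noteq> 0" "dw \<noteq> 0" using mob_denominator_nonzero a z w by (simp_all add: dz_def dw_def)
  have den: "1 - cnj a * (z + w) + (cnj a)\<^sup>2 * (z * w) = dz * dw"
    by (simp add: dz_def dw_def power2_eq_square algebra_simps)
  have "((1 + a * cnj a) * (z + w) - 2 * a - 2 * cnj a * (z * w)) / (dz * dw) = (z - a) / dz + (w - a) / dw"
    using d by (simp add: add_frac_eq) (simp add: dz_def dw_def algebra_simps)
  moreover have "(z * w - a * (z + w) + a\<^sup>2) / (dz * dw) = (z - a) / dz * ((w - a) / dw)"
    by (simp add: power2_eq_square algebra_simps)
  ultimately show ?thesis
    unfolding symmetrized_mob_def vector_2 den Moebius_function_simple dz_def[symmetric] dw_def[symmetric]
    by (simp only:)
qed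

lemma mem_symmetrized_bidiscE:
  assumes "x \<in> symmetrized_bidisc"
  obtains z w where "norm z < 1" "norm w < 1" "x = vector [z + w, z * w]"
  using assms unfolding symmetrized_bidisc_def by auto

lemma symmetrized_mob_mem:
  assumes "norm a < 1" "x \<in> symmetrized_bidisc"
  shows "symmetrized_mob a x \<in> symmetrized_bidisc"
proof -
  obtain z w where zw: "norm z < 1" "norm w < 1" "x = vector [z + w, z * w]"
    using assms(2) by (rule mem_symmetrized_bidiscE)
  then have "symmetrized_mob a x = vector [mob a z + mob a w, mob a z * mob a w]"
    using symmetrized_mob_eq assms(1) by simp
  then show ?thesis unfolding symmetrized_bidisc_def
    using Moebius_function_norm_lt_1[OF assms(1)] zw by auto
qed

lemma symmetrized_mob_inverse:
  assumes "norm a < 1" "x \<in> symmetrized_bidisc"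
  shows "symmetrized_mob (- a) (symmetrized_mob a x) = x"
proof -
  obtain z w where zw: "norm z < 1" "norm w < 1" "x = vector [z + w, z * w]"
    using assms(2) by (rule mem_symmetrized_bidiscE)
  then show ?thesis
    using assms(1) by (simp add: symmetrized_mob_eq Moebius_function_norm_lt_1 Moebius_function_compose)
qed

lemma point_of_symmetry_symmetrized_mob:
  assumes "point_of_symmetry symmetrized_bidisc l" "norm a < 1"
  shows "point_of_symmetry symmetrized_bidisc (symmetrized_mob a l)"
proof (rule point_of_symmetry_automorphism[OF assms(1), where g = "symmetrized_mob (- a)"])
  have hol: "holomorphic_map_on (symmetrized_mob a) symmetrized_bidisc" if "norm a < 1" for a
  proof (rule holomorphic_map_onI)
    fix x :: "complex^2" and i :: 2 assume "x \<in> symmetrized_bidisc"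
    then have d: "1 - cnj a * x$1 + (cnj a)\<^sup>2 * x$2 \<noteq> 0"
      using symmetrized_mob_denominator[OF that] by (auto elim!: mem_symmetrized_bidiscE)
    have "\<forall>i. complex_linear_derivative_at (\<lambda>x. symmetrized_mob a x $ i) x"
      unfolding forall_2 symmetrized_mob_def vector_2
      by (intro conjI complex_linear_derivative_at_intros d)
    then show "complex_linear_derivative_at (\<lambda>x. symmetrized_mob a x $ i) x" by blast
  qed
  show "holomorphic_map_on (symmetrized_mob a) symmetrized_bidisc"
    "holomorphic_map_on (symmetrized_mob (- a)) symmetrized_bidisc"
    using hol assms(2) by auto
  show "symmetrized_mob a ` symmetrized_bidisc \<subseteq> symmetrized_bidisc"
    "symmetrized_mob (- a) ` symmetrized_bidisc \<subseteq> symmetrized_bidisc"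
    using symmetrized_mob_mem assms(2) by auto
qed (use symmetrized_mob_inverse[of a] symmetrized_mob_inverse[of "- a"] assms(2) in auto)

text \<open>The pair \<open>{z, w}\<close> is moved to \<open>{0, t}\<close>, and then the hyperbolic midpoint \<open>a\<close> of \<open>0\<close> and \<open>t\<close> is moved to \<open>0\<close>,
  which makes the two entries opposite.\<close>

lemma symmetrized_bidisc_symmetry_at_flat_point:
  assumes l: "point_of_symmetry symmetrized_bidisc l"
  obtains a where "norm a < 1" "point_of_symmetry symmetrized_bidisc (vector [0, a])"
proof -
  have "l \<in> symmetrized_bidisc" using l unfolding point_of_symmetry_def isolated_in_def by auto
  then obtain z w where zw: "norm z < 1" "norm w < 1" and leq: "l = vector [z + w, z * w]"
    by (rule mem_symmetrized_bidiscE)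
  define t where "t = mob z w"
  have t: "norm t < 1" unfolding t_def using zw by (rule Moebius_function_norm_lt_1)
  have "symmetrized_mob z l = vector [0 + t, 0 * t]"
    unfolding leq symmetrized_mob_eq[OF zw(1) zw] by (simp add: t_def Moebius_function_eq_zero)
  then have sym: "point_of_symmetry symmetrized_bidisc (vector [0 + t, 0 * t])"
    using point_of_symmetry_symmetrized_mob[OF l zw(1)] by simp
  define r where "r = sqrt (1 - (norm t)\<^sup>2)"
  have r: "r \<ge> 0" "r\<^sup>2 = 1 - (norm t)\<^sup>2" using t by (simp_all add: r_def power_le_one)
  \<comment> \<open>\<open>c * t\<close> is the hyperbolic midpoint of \<open>0\<close> and \<open>t\<close>\<close>
  define c where "c = 1 / (1 + r)"
  have c: "c > 0" "c \<le> 1" "c * (1 + r) = 1" using r(1) by (auto simp: c_def)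
  define a where "a = of_real c * t"
  have a: "norm a < 1" using c t mult_left_le_one_le[of "norm t" c] by (simp add: a_def norm_mult)
  have cr: "c\<^sup>2 * (norm t)\<^sup>2 + 1 = 2 * c"
  proof -
    have "(1 + r) * (c\<^sup>2 * (norm t)\<^sup>2 + 1 - 2 * c) = 0" using c(3) r(2) by algebra
    then show ?thesis using r(1) by simp
  qed
  have "(a * cnj a + 1) * t = 2 * a"
  proof -
    have "a * cnj a = of_real (c\<^sup>2 * (norm t)\<^sup>2)"
      using complex_norm_square[of t] by (simp add: a_def power2_eq_square algebra_simps)
    then have "a * cnj a + 1 = of_real (2 * c)" by (metis cr of_real_1 of_real_add)
    then show ?thesis by (simp add: a_def)
  qed
  moreover have d: "1 - cnj a * t \<noteq> 0" by (rule mob_denominator_nonzero[OF a t])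
  ultimately have "mob a 0 + mob a t = 0"
    by (simp add: Moebius_function_simple field_simps)
  then have "symmetrized_mob a (vector [0 + t, 0 * t]) = vector [0, mob a 0 * mob a t]"
    using symmetrized_mob_eq[OF a _ t, of 0] by simp
  then have "point_of_symmetry symmetrized_bidisc (vector [0, mob a 0 * mob a t])"
    using point_of_symmetry_symmetrized_mob[OF sym a] by simp
  moreover have "norm (mob a 0 * mob a t) < 1"
    using Moebius_function_norm_lt_1[OF a, of 0] Moebius_function_norm_lt_1[OF a t] norm_mult_less[of "mob a 0" 1 "mob a t" 1]
    by simp
  ultimately show ?thesis using that by blast
qed

section \<open>No symmetry at a flat point\<close>

text \<open>On the vectors \<open>(\<sigma>, cnj \<sigma>)\<close> the product of the two linear forms, with coefficients \<open>\<alpha>\<close>, \<open>\<beta>\<close>, \<open>\<gamma>\<close>, is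
  \<open>\<beta> + e\<close>, where \<open>e\<close> runs through a centrally symmetric
  ellipse with major semi-axis \<open>norm \<alpha> + norm \<gamma>\<close>, and the determinant satisfies
  \<open>det\<^sup>2 = \<beta>\<^sup>2 - 4 \<alpha> \<gamma>\<close>: it is a discriminant. One of \<open>\<beta> + e\<close>, \<open>\<beta> - e\<close> is large enough by the parallelogram
  law.\<close>

lemma product_of_linear_forms_ge_det:
  fixes A11 A12 A21 A22 :: complex
  obtains \<sigma> where "norm \<sigma> = 1"
    "norm (A11 * A22 - A12 * A21) \<le> norm ((\<sigma> * A11 + cnj \<sigma> * A12) * (\<sigma> * A21 + cnj \<sigma> * A22))"
proof -
  define \<alpha> \<beta> \<gamma> where "\<alpha> = A11 * A21" and "\<beta> = A11 * A22 + A12 * A21" and "\<gamma> = A12 * A22"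
  obtain w where w: "norm w = 1" "norm (cnj w * \<gamma> + w * \<alpha>) = norm \<gamma> + norm \<alpha>"
    using align_phases[of \<gamma> \<alpha>] by metis
  define e where "e = cnj w * \<gamma> + w * \<alpha>"
  have prod: "\<exists>\<sigma>. norm \<sigma> = 1 \<and> (\<sigma> * A11 + cnj \<sigma> * A12) * (\<sigma> * A21 + cnj \<sigma> * A22) = \<beta> + (cnj v * \<gamma> + v * \<alpha>)"
    if v: "norm v = 1" for v
  proof (intro exI conjI)
    define \<sigma> where "\<sigma> = csqrt v"
    have s2: "\<sigma>\<^sup>2 = v" by (simp add: \<sigma>_def)
    then have "(norm \<sigma>)\<^sup>2 = 1" using v by (metis norm_power)
    then show n: "norm (csqrt v) = 1" using norm_ge_zero[of \<sigma>] by (auto simp: power2_eq_1_iff \<sigma>_def)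
    have sc: "\<sigma> * cnj \<sigma> = 1" using n complex_norm_square[of \<sigma>] by (simp add: \<sigma>_def)
    have "(\<sigma> * A11 + cnj \<sigma> * A12) * (\<sigma> * A21 + cnj \<sigma> * A22)
       = (\<sigma> * cnj \<sigma>) * \<beta> + (cnj (\<sigma>\<^sup>2) * \<gamma> + \<sigma>\<^sup>2 * \<alpha>)"
      by (simp add: \<alpha>_def \<beta>_def \<gamma>_def power2_eq_square algebra_simps)
    then show "(csqrt v * A11 + cnj (csqrt v) * A12) * (csqrt v * A21 + cnj (csqrt v) * A22)
       = \<beta> + (cnj v * \<gamma> + v * \<alpha>)"
      unfolding sc s2 by (simp add: \<sigma>_def)
  qed
  define N where "N = norm (A11 * A22 - A12 * A21)"
  have "N\<^sup>2 = norm (\<beta>\<^sup>2 - 4 * \<alpha> * \<gamma>)"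
    unfolding N_def norm_power[symmetric]
    by (simp add: \<alpha>_def \<beta>_def \<gamma>_def power2_eq_square algebra_simps)
  also have "\<dots> \<le> norm (\<beta>\<^sup>2) + norm (4 * \<alpha> * \<gamma>)" by (rule norm_triangle_ineq4)
  also have "\<dots> = (norm \<beta>)\<^sup>2 + 4 * (norm \<alpha> * norm \<gamma>)" by (simp add: norm_mult norm_power)
  also have "\<dots> \<le> (norm \<beta>)\<^sup>2 + (norm \<gamma> + norm \<alpha>)\<^sup>2"
    using sum_squares_bound[of "norm \<gamma>" "norm \<alpha>"] by (simp add: power2_eq_square algebra_simps)
  finally have N: "N\<^sup>2 \<le> (norm \<beta>)\<^sup>2 + (norm e)\<^sup>2" by (simp add: e_def w)
  have par: "(norm (\<beta> + e))\<^sup>2 + (norm (\<beta> - e))\<^sup>2 = 2 * ((norm \<beta>)\<^sup>2 + (norm e)\<^sup>2)"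
    by (simp only: cmod_power2) (simp add: power2_eq_square algebra_simps)
  have "N \<le> norm (\<beta> + e) \<or> N \<le> norm (\<beta> - e)"
  proof (rule ccontr)
    assume "\<not> ?thesis"
    then have "(norm (\<beta> + e))\<^sup>2 < N\<^sup>2" "(norm (\<beta> - e))\<^sup>2 < N\<^sup>2"
      by (simp_all add: power_strict_mono)
    then have "(norm (\<beta> + e))\<^sup>2 + (norm (\<beta> - e))\<^sup>2 < N\<^sup>2 + N\<^sup>2" by (rule add_strict_mono)
    also have "\<dots> \<le> 2 * ((norm \<beta>)\<^sup>2 + (norm e)\<^sup>2)" using N by simp
    finally show False unfolding par by simp
  qed
  then show ?thesis
  proof
    assume "N \<le> norm (\<beta> + e)"
    then show ?thesis using prod[OF w(1)] that unfolding N_def e_def by metis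
  next
    assume "N \<le> norm (\<beta> - e)"
    moreover have "\<beta> - e = \<beta> + (cnj (- w) * \<gamma> + (- w) * \<alpha>)" by (simp add: e_def)
    moreover have "norm (- w) = 1" using w by simp
    ultimately show ?thesis using prod[of "- w"] that unfolding N_def by metis
  qed
qed

lemma disc_involution_centre:
  assumes "norm a < 1" "mob (- a) (- mob a 0) = 0"
  shows "a = 0"
proof -
  have "mob a (mob (- a) (- mob a 0)) = - mob a 0"
    using assms(1) Moebius_function_norm_lt_1[of a 0 0] Moebius_function_compose[of a "- a"]
      Moebius_function_compose[of "- (- a)" "- a" "- mob a 0"] by simp
  then have "mob a 0 = - mob a 0" using assms(2) by simp
  then show "a = 0" by (simp add: Moebius_function_of_zero)
qed

lemma disc_involution:
  assumes "norm a < 1" "norm t < 1"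
  shows "norm (mob (- a) (- mob a t)) < 1"
  using assms by (intro Moebius_function_norm_lt_1) (simp_all add: Moebius_function_norm_lt_1)

text \<open>Rigidity makes the symmetry act on the flat disc by the Moebius involution \<open>m\<close> about \<open>a\<close>, so its
  Jacobians \<open>P q\<close> over the flat disc are block triangular. The transverse 2 by 2 block is tested on the
  vectors \<open>(\<sigma>, cnj \<sigma>)\<close>, which are the velocities of the rotated discs, and its determinant is the
  quantity \<open>D\<close> of \<open>no_flat_symmetry\<close>.\<close>

lemma no_symmetry_at_flat_point_tetrablock:
  assumes a: "norm a < 1"
  shows "\<not> point_of_symmetry tetrablock (vector [0, 0, a])"
proof
  define flat :: "complex \<Rightarrow> complex^3" where "flat q = vector [0, 0, q]" for q
  assume "point_of_symmetry tetrablock (vector [0, 0, a])"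
  then obtain \<gamma> where hol: "holomorphic_map_on \<gamma> tetrablock" and S: "\<gamma> ` tetrablock \<subseteq> tetrablock"
    and inv: "\<And>x. x \<in> tetrablock \<Longrightarrow> \<gamma> (\<gamma> x) = x" and iso: "flat a isolated_in {x\<in>tetrablock. \<gamma> x = x}"
    unfolding point_of_symmetry_def flat_def by blast
  obtain J where J: "\<And>x. x \<in> tetrablock \<Longrightarrow> (\<gamma> has_derivative (\<lambda>h. J x *v h)) (at x)"
    using hol unfolding holomorphic_map_on_open[OF open_tetrablock] by blast
  note Jl = jacobian_at_isolated_fixed_point[OF open_tetrablock J S inv iso]
  have fixa: "\<gamma> (flat a) = flat a" using iso by (simp add: isolated_in_def)
  have flat_nth: "flat q $ 1 = 0" "flat q $ 2 = 0" "flat q $ 3 = q" for q by (simp_all add: flat_def)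
  have flat_mem: "flat q \<in> tetrablock" if "norm q < 1" for q
    using tetra_symmetrization[of "csqrt (- q)" "- csqrt (- q)"] that
    by (simp add: mem_tetrablock_iff flat_def norm_csqrt flip: power2_eq_square)
  have mv: "(M *v h) $ i = M$i$1 * h$1 + M$i$2 * h$2 + M$i$3 * h$3" for M :: "complex^3^3" and h i
    by (simp add: matrix_vector_mult_def sum_3)
  define P where "P q = J (flat q)" for q
  have dflat: "((\<lambda>t. flat t $ j) has_field_derivative vector [0, 0, 1] $ j) (at t)" for t and j :: 3
  proof -
    have "\<forall>j. ((\<lambda>t. flat t $ j) has_field_derivative vector [0, 0, 1] $ j) (at t)"
      unfolding forall_3 flat_def by (auto intro!: derivative_eq_intros)
    then show ?thesis by blast
  qed
  have D\<gamma>: "((\<lambda>t. \<gamma> (flat t) $ i) has_field_derivative P q $ i $ 3) (at q)" if "norm q < 1" for q i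
    using has_field_derivative_component_comp[OF J[OF flat_mem[OF that]] dflat, of i]
    by (simp add: mv P_def)
  define m where "m t = mob (- a) (- mob a t)" for t
  have flat_eq: "\<gamma> (flat t) = flat (m t)" if t: "norm t < 1" for t
  proof -
    have hol: "(\<lambda>t. \<gamma> (flat t) $ i) holomorphic_on ball 0 1" for i
      using D\<gamma> by (intro holomorphic_onI) (auto simp: field_differentiable_def intro: has_field_derivative_at_within)
    have mem: "tetra (\<gamma> (flat t) $ 1) (\<gamma> (flat t) $ 2) (\<gamma> (flat t) $ 3)" if "norm t < 1" for t
      using flat_mem[OF that] S by (auto simp: mem_tetrablock_iff[symmetric])
    have Pa: "P a $ 1 $ 3 = 0" "P a $ 2 $ 3 = 0" "P a $ 3 $ 3 = -1"
      using Jl[of "vector [0, 0, 1]"] by (simp_all add: vec_eq_iff mv forall_3 P_def)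
    have "\<gamma> (flat t) $ 1 = 0 \<and> \<gamma> (flat t) $ 2 = 0 \<and> \<gamma> (flat t) $ 3 = m t"
      unfolding m_def
      by (rule flat_disc_rigidity[OF hol hol hol mem a])
        (use D\<gamma>[OF a, of 1] D\<gamma>[OF a, of 2] D\<gamma>[OF a, of 3] Pa t in \<open>simp_all add: fixa flat_nth\<close>)
    then show ?thesis by (simp add: vec_eq_iff forall_3 flat_def)
  qed
  have m1: "norm (m q) < 1" if "norm q < 1" for q unfolding m_def by (rule disc_involution[OF a that])
  have mm: "m (m q) = q" if "norm q < 1" for q
  proof -
    have "flat (m (m q)) = flat q"
      using inv[OF flat_mem[OF that]] by (simp add: flat_eq that m1)
    then have "flat (m (m q)) $ 3 = flat q $ 3" by simp
    then show ?thesis by (simp add: flat_def)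
  qed
  have P13: "P q $ 1 $ 3 = 0" "P q $ 2 $ 3 = 0" and Pm: "(m has_field_derivative P q $ 3 $ 3) (at q)"
    if q: "norm q < 1" for q
  proof -
    have *: "((\<lambda>t. flat (m t) $ i) has_field_derivative P q $ i $ 3) (at q)" for i
      by (rule has_field_derivative_transform_within_open[OF D\<gamma>[OF q], of "ball 0 1"]) (use q in \<open>auto simp: flat_eq\<close>)
    show "P q $ 1 $ 3 = 0" "P q $ 2 $ 3 = 0"
      using *[of 1] *[of 2] by (auto simp: flat_def intro: DERIV_unique)
    show "(m has_field_derivative P q $ 3 $ 3) (at q)" using *[of 3] by (simp add: flat_def)
  qed
  have PP: "P (m q) *v (P q *v h) = h" if "norm q < 1" for q h
    using involution_jacobian[OF open_tetrablock J S inv flat_mem[OF that]] by (simp add: P_def flat_eq that)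
  define det where "det q = P q $ 1 $ 1 * P q $ 2 $ 2 - P q $ 1 $ 2 * P q $ 2 $ 1" for q
  have inv_entries: "det q * det (m q) = 1" "P q $ 3 $ 3 \<noteq> 0" if q: "norm q < 1" for q
  proof -
    note e = PP[OF q, of "vector [1, 0, 0]"] PP[OF q, of "vector [0, 1, 0]"] PP[OF q, of "vector [0, 0, 1]"]
    note z = P13[OF q] P13[OF m1[OF q]]
    let ?A = "P q" and ?B = "P (m q)"
    have "?B$1$1 * ?A$1$1 + ?B$1$2 * ?A$2$1 = 1" "?B$2$1 * ?A$1$1 + ?B$2$2 * ?A$2$1 = 0"
      using e(1) z by (simp_all add: vec_eq_iff mv forall_3)
    moreover have "?B$1$1 * ?A$1$2 + ?B$1$2 * ?A$2$2 = 0" "?B$2$1 * ?A$1$2 + ?B$2$2 * ?A$2$2 = 1"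
      using e(2) z by (simp_all add: vec_eq_iff mv forall_3)
    ultimately show "det q * det (m q) = 1" unfolding det_def by algebra
    have "?B$3$3 * ?A$3$3 = 1" using e(3) z by (simp_all add: vec_eq_iff mv forall_3)
    then show "?A$3$3 \<noteq> 0" by auto
  qed
  define y1 y2 x where "y1 q \<sigma> = \<sigma> * P q $ 1 $ 1 + cnj \<sigma> * P q $ 1 $ 2"
    and "y2 q \<sigma> = \<sigma> * P q $ 2 $ 1 + cnj \<sigma> * P q $ 2 $ 2"
    and "x q \<sigma> = \<sigma> * P q $ 3 $ 1 + cnj \<sigma> * P q $ 3 $ 2" for q \<sigma>
  show False
  proof (rule no_flat_symmetry[where m = m and D = "\<lambda>q. norm (det q)" and \<kappa> = "\<lambda>q. P q $ 3 $ 3"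
        and ?y1.0 = y1 and ?y2.0 = y2 and x = x])
    fix q \<sigma> :: complex assume q: "norm q < 1" and \<sigma>: "norm \<sigma> = 1"
    show "disc_transport q (m q) (y1 q \<sigma>) (y2 q \<sigma>) (x q \<sigma>) (P q $ 3 $ 3)"
      unfolding disc_transport_def
    proof (intro allI impI)
      fix s p \<alpha> \<beta>
      assume hs: "s holomorphic_on ball 0 1" and hp: "p holomorphic_on ball 0 1"
        and mem: "\<forall>t. norm t < 1 \<longrightarrow> (\<exists>z w. norm z < 1 \<and> norm w < 1 \<and> s t = z + w \<and> p t = z * w)"
        and 0: "s 0 = 0" "p 0 = q"
        and D: "(s has_field_derivative 2 * \<alpha>) (at 0)" "(p has_field_derivative \<beta>) (at 0)"
      define d :: "complex \<Rightarrow> complex^3" where "d t = vector [\<sigma> * (s t / 2), cnj \<sigma> * (s t / 2), p t]" for t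
      have "\<sigma> * cnj \<sigma> = 1" using \<sigma> complex_norm_square[of \<sigma>] by simp
      then have d_mem: "d t \<in> tetrablock" if "t \<in> ball 0 1" for t
      proof -
        from that have "norm t < 1" by simp
        then obtain z w where zw: "norm z < 1" "norm w < 1" "s t = z + w" "p t = z * w" using mem by blast
        show ?thesis
          using tetra_rotate[OF tetra_symmetrization[OF zw(1,2)] \<sigma>, of "cnj \<sigma>"] \<sigma> \<open>\<sigma> * cnj \<sigma> = 1\<close>
          by (simp add: mem_tetrablock_iff d_def zw)
      qed
      have d0: "d 0 = flat q" by (simp add: d_def flat_def 0)
      have "\<forall>j. (\<lambda>t. d t $ j) holomorphic_on ball 0 1"
        unfolding forall_3 d_def vector_3 by (intro conjI holomorphic_intros hs hp) auto
      then have hd: "(\<lambda>t. \<gamma> (d t) $ i) holomorphic_on ball 0 1" for i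
        by (intro holomorphic_on_component_comp[OF J _ open_ball d_mem]) auto
      have "\<forall>j. ((\<lambda>t. d t $ j) has_field_derivative vector [\<sigma> * \<alpha>, cnj \<sigma> * \<alpha>, \<beta>] $ j) (at 0)"
        unfolding forall_3 d_def vector_3 using D by (auto intro!: derivative_eq_intros)
      then have "((\<lambda>t. \<gamma> (d t) $ i) has_field_derivative (P q *v vector [\<sigma> * \<alpha>, cnj \<sigma> * \<alpha>, \<beta>]) $ i) (at 0)" for i
        using has_field_derivative_component_comp[of \<gamma> "P q" d 0] J[OF flat_mem[OF q]] by (simp add: d0 P_def)
      then have Dd: "((\<lambda>t. \<gamma> (d t) $ i) has_field_derivative \<alpha> * (\<sigma> * P q $ i $ 1 + cnj \<sigma> * P q $ i $ 2) + \<beta> * P q $ i $ 3) (at 0)" for i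
        by (simp add: mv algebra_simps)
      have tet: "tetra (\<gamma> (d t) $ 1) (\<gamma> (d t) $ 2) (\<gamma> (d t) $ 3)" if "norm t < 1" for t
        using d_mem[of t] that S by (auto simp: mem_tetrablock_iff[symmetric])
      have "\<gamma> (d 0) $ 1 = 0" "\<gamma> (d 0) $ 2 = 0" "\<gamma> (d 0) $ 3 = m q"
        unfolding d0 flat_eq[OF q] by (simp_all add: flat_def)
      then show "\<exists>f1 f2 f3. f1 holomorphic_on ball 0 1 \<and> f2 holomorphic_on ball 0 1 \<and> f3 holomorphic_on ball 0 1 \<and>
        (\<forall>t. norm t < 1 \<longrightarrow> tetra (f1 t) (f2 t) (f3 t)) \<and> f1 0 = 0 \<and> f2 0 = 0 \<and> f3 0 = m q \<and>
        (f1 has_field_derivative \<alpha> * y1 q \<sigma>) (at 0) \<and> (f2 has_field_derivative \<alpha> * y2 q \<sigma>) (at 0) \<and>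
        (f3 has_field_derivative \<alpha> * x q \<sigma> + \<beta> * P q $ 3 $ 3) (at 0)"
        using hd tet Dd[of 1] Dd[of 2] Dd[of 3] P13[OF q]
        by (intro exI[of _ "\<lambda>t. \<gamma> (d t) $ 1"] exI[of _ "\<lambda>t. \<gamma> (d t) $ 2"] exI[of _ "\<lambda>t. \<gamma> (d t) $ 3"])
          (simp add: y1_def y2_def x_def)
    qed
  next
    fix q :: complex assume q: "norm q < 1"
    show "norm (det q) * norm (det (m q)) = 1"
      using inv_entries(1)[OF q] by (metis norm_mult norm_one)
    show "\<exists>\<sigma>. norm \<sigma> = 1 \<and> norm (det q) \<le> norm (y1 q \<sigma> * y2 q \<sigma>)"
      using product_of_linear_forms_ge_det unfolding det_def y1_def y2_def by metis
  next
    assume "m 0 = 0"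
    then have a0: "a = 0" using disc_involution_centre[OF a] by (simp add: m_def)
    then have mneg: "m = uminus" by (simp add: m_def fun_eq_iff Moebius_function_simple)
    have \<kappa>: "P q $ 3 $ 3 = -1" if "norm q < 1" for q
    proof -
      have "(uminus has_field_derivative (-1::complex)) (at q)" by (auto intro!: derivative_eq_intros)
      then show ?thesis using Pm[OF that] DERIV_unique unfolding mneg by blast
    qed
    have "P 0 *v h = - h" for h using Jl[of h] by (simp add: P_def a0)
    from this[of "vector [1, 0, 0]"] this[of "vector [0, 1, 0]"]
    have P0: "P 0 $ 1 $ 1 = -1" "P 0 $ 1 $ 2 = 0" "P 0 $ 2 $ 1 = 0" "P 0 $ 2 $ 2 = -1"
      by (simp_all add: vec_eq_iff mv forall_3)
    \<comment> \<open>the distance of the transverse block from its value at \<open>q = 0\<close>\<close>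
    define F where "F q = norm (P q $ 1 $ 1 + 1) + norm (P q $ 1 $ 2) + (norm (P q $ 2 $ 1) + norm (P q $ 2 $ 2 + 1))" for q
    have "continuous_on (ball 0 1) (\<lambda>t. \<chi> i. flat t $ i)"
      by (intro continuous_on_vec_lambda continuous_at_imp_continuous_on ballI DERIV_isCont[OF dflat])
    then have contflat: "continuous_on (ball 0 1) flat" by simp
    have contJ: "continuous_on tetrablock J" by (rule continuous_on_jacobian[OF open_tetrablock J])
    have "flat ` ball 0 1 \<subseteq> tetrablock" by (rule image_subsetI) (simp add: flat_mem)
    then have "continuous_on (ball 0 1) P"
      unfolding P_def by (rule continuous_on_compose2[OF contJ contflat])
    then have F: "continuous_on (ball 0 1) F" unfolding F_def by (intro continuous_intros)
    have "F 0 = 0" by (simp add: F_def P0)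
    then obtain e where e: "e > 0" "\<And>q. q \<in> ball 0 1 \<Longrightarrow> dist q 0 < e \<Longrightarrow> dist (F q) 0 < 1/2"
      using F[unfolded continuous_on_iff, rule_format, of 0 "1/2"] by auto
    have "Re (y1 q \<sigma> * y2 q \<sigma>) > 0" if q: "norm q < min e 1" and \<sigma>: "norm \<sigma> = 1" for q \<sigma>
    proof -
      \<comment> \<open>the deviations of \<open>y1\<close> and \<open>y2\<close> from \<open>- \<sigma>\<close> and \<open>- cnj \<sigma>\<close>\<close>
      define e1 where "e1 = \<sigma> * (P q $ 1 $ 1 + 1) + cnj \<sigma> * P q $ 1 $ 2"
      define e2 where "e2 = \<sigma> * P q $ 2 $ 1 + cnj \<sigma> * (P q $ 2 $ 2 + 1)"
      have n1: "norm e1 \<le> norm (P q $ 1 $ 1 + 1) + norm (P q $ 1 $ 2)"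
        unfolding e1_def using \<sigma> by (intro norm_triangle_le) (simp add: norm_mult)
      have n2: "norm e2 \<le> norm (P q $ 2 $ 1) + norm (P q $ 2 $ 2 + 1)"
        unfolding e2_def using \<sigma> by (intro norm_triangle_le) (simp add: norm_mult)
      have "F q < 1/2" using e(2)[of q] q by (simp add: dist_norm)
      then have ne: "norm e1 + norm e2 < 1/2" using n1 n2 by (simp add: F_def)
      have "\<sigma> * cnj \<sigma> = 1" using \<sigma> complex_norm_square[of \<sigma>] by simp
      then have expand: "(e1 - \<sigma>) * (e2 - cnj \<sigma>) = 1 - (\<sigma> * e2 + cnj \<sigma> * e1 - e1 * e2)"
        by (simp add: algebra_simps)
      have "y1 q \<sigma> = e1 - \<sigma>" "y2 q \<sigma> = e2 - cnj \<sigma>"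
        by (simp_all add: y1_def y2_def e1_def e2_def algebra_simps)
      then have eq: "y1 q \<sigma> * y2 q \<sigma> = 1 - (\<sigma> * e2 + cnj \<sigma> * e1 - e1 * e2)"
        by (simp only: expand)
      have "norm (\<sigma> * e2 + cnj \<sigma> * e1 - e1 * e2) \<le> norm e2 + norm e1 + norm e1 * norm e2"
        using norm_triangle_ineq4[of "\<sigma> * e2 + cnj \<sigma> * e1" "e1 * e2"] norm_triangle_ineq[of "\<sigma> * e2" "cnj \<sigma> * e1"] \<sigma>
        by (simp add: norm_mult)
      moreover have "norm e1 \<le> 1/2" "norm e2 \<le> 1"
        using ne norm_ge_zero[of e1] norm_ge_zero[of e2] by linarith+
      then have "norm e1 * norm e2 \<le> 1/2 * 1" by (intro mult_mono) auto
      ultimately have "norm (\<sigma> * e2 + cnj \<sigma> * e1 - e1 * e2) < 1" using ne by linarith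
      then have "Re (\<sigma> * e2 + cnj \<sigma> * e1 - e1 * e2) < 1" using complex_Re_le_cmod le_less_trans by blast
      then show ?thesis unfolding eq by simp
    qed
    then show "(\<forall>q. norm q < 1 \<longrightarrow> m q = - q \<and> P q $ 3 $ 3 = - 1) \<and>
        (\<exists>e>0. \<forall>q \<sigma>. norm q < e \<longrightarrow> norm \<sigma> = 1 \<longrightarrow> Re (y1 q \<sigma> * y2 q \<sigma>) > 0)"
      using \<kappa> mneg e(1) by (intro conjI exI[of _ "min e 1"]) auto
  qed (use m1 mm inv_entries in auto)
qed

text \<open>The same argument through \<open>(s, p) \<mapsto> (s/2, s/2, p)\<close>. The transverse block is now the scalar
  \<open>P q $ 1 $ 1\<close>, which plays the role of both \<open>y1\<close> and \<open>y2\<close>.\<close>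

lemma no_symmetry_at_flat_point_symmetrized_bidisc:
  assumes a: "norm a < 1"
  shows "\<not> point_of_symmetry symmetrized_bidisc (vector [0, a])"
proof
  define flat :: "complex \<Rightarrow> complex^2" where "flat q = vector [0, q]" for q
  assume "point_of_symmetry symmetrized_bidisc (vector [0, a])"
  then obtain \<gamma> where hol: "holomorphic_map_on \<gamma> symmetrized_bidisc"
    and S: "\<gamma> ` symmetrized_bidisc \<subseteq> symmetrized_bidisc"
    and inv: "\<And>x. x \<in> symmetrized_bidisc \<Longrightarrow> \<gamma> (\<gamma> x) = x"
    and iso: "flat a isolated_in {x\<in>symmetrized_bidisc. \<gamma> x = x}"
    unfolding point_of_symmetry_def flat_def by blast
  obtain J where J: "\<And>x. x \<in> symmetrized_bidisc \<Longrightarrow> (\<gamma> has_derivative (\<lambda>h. J x *v h)) (at x)"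
    using hol unfolding holomorphic_map_on_open[OF open_symmetrized_bidisc] by blast
  note Jl = jacobian_at_isolated_fixed_point[OF open_symmetrized_bidisc J S inv iso]
  have fixa: "\<gamma> (flat a) = flat a" using iso by (simp add: isolated_in_def)
  have flat_nth: "flat q $ 1 = 0" "flat q $ 2 = q" for q by (simp_all add: flat_def)
  have flat_mem: "flat q \<in> symmetrized_bidisc" if "norm q < 1" for q
    using tetra_symmetrization[of "csqrt (- q)" "- csqrt (- q)"] that
    by (simp add: mem_symmetrized_bidisc_iff flat_def norm_csqrt flip: power2_eq_square)
  have mv: "(M *v h) $ i = M$i$1 * h$1 + M$i$2 * h$2" for M :: "complex^2^2" and h i
    by (simp add: matrix_vector_mult_def sum_2)
  define P where "P q = J (flat q)" for q
  have dflat: "((\<lambda>t. flat t $ j) has_field_derivative vector [0, 1] $ j) (at t)" for t and j :: 2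
  proof -
    have "\<forall>j. ((\<lambda>t. flat t $ j) has_field_derivative vector [0, 1] $ j) (at t)"
      unfolding forall_2 flat_def by (auto intro!: derivative_eq_intros)
    then show ?thesis by blast
  qed
  have D\<gamma>: "((\<lambda>t. \<gamma> (flat t) $ i) has_field_derivative P q $ i $ 2) (at q)" if "norm q < 1" for q i
    using has_field_derivative_component_comp[OF J[OF flat_mem[OF that]] dflat, of i]
    by (simp add: mv P_def)
  define m where "m t = mob (- a) (- mob a t)" for t
  have flat_eq: "\<gamma> (flat t) = flat (m t)" if t: "norm t < 1" for t
  proof -
    have hol: "(\<lambda>t. \<gamma> (flat t) $ i) holomorphic_on ball 0 1" for i
      using D\<gamma> by (intro holomorphic_onI) (auto simp: field_differentiable_def intro: has_field_derivative_at_within)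
    have hol1: "(\<lambda>t. \<gamma> (flat t) $ 1 / 2) holomorphic_on ball 0 1" by (intro holomorphic_intros hol) auto
    have mem: "tetra (\<gamma> (flat t) $ 1 / 2) (\<gamma> (flat t) $ 1 / 2) (\<gamma> (flat t) $ 2)" if "norm t < 1" for t
      using flat_mem[OF that] S by (auto simp: mem_symmetrized_bidisc_iff[symmetric])
    have Pa: "P a $ 1 $ 2 = 0" "P a $ 2 $ 2 = -1"
      using Jl[of "vector [0, 1]"] by (simp_all add: vec_eq_iff mv forall_2 P_def)
    have D1: "((\<lambda>t. \<gamma> (flat t) $ 1 / 2) has_field_derivative 0) (at a)"
      using DERIV_cdivide[OF D\<gamma>[OF a, of 1], of 2] by (simp add: Pa)
    have "\<gamma> (flat t) $ 1 / 2 = 0 \<and> \<gamma> (flat t) $ 1 / 2 = 0 \<and> \<gamma> (flat t) $ 2 = m t"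
      unfolding m_def
      by (rule flat_disc_rigidity[OF hol1 hol1 hol mem a])
        (use D1 D\<gamma>[OF a, of 2] Pa t in \<open>simp_all add: fixa flat_nth\<close>)
    then show ?thesis by (simp add: vec_eq_iff forall_2 flat_def)
  qed
  have m1: "norm (m q) < 1" if "norm q < 1" for q unfolding m_def by (rule disc_involution[OF a that])
  have mm: "m (m q) = q" if "norm q < 1" for q
  proof -
    have "flat (m (m q)) = flat q"
      using inv[OF flat_mem[OF that]] by (simp add: flat_eq that m1)
    then have "flat (m (m q)) $ 2 = flat q $ 2" by simp
    then show ?thesis by (simp add: flat_def)
  qed
  have P12: "P q $ 1 $ 2 = 0" and Pm: "(m has_field_derivative P q $ 2 $ 2) (at q)"
    if q: "norm q < 1" for q
  proof -
    have *: "((\<lambda>t. flat (m t) $ i) has_field_derivative P q $ i $ 2) (at q)" for i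
      by (rule has_field_derivative_transform_within_open[OF D\<gamma>[OF q], of "ball 0 1"]) (use q in \<open>auto simp: flat_eq\<close>)
    show "P q $ 1 $ 2 = 0"
      using *[of 1] by (auto simp: flat_def intro: DERIV_unique)
    show "(m has_field_derivative P q $ 2 $ 2) (at q)" using *[of 2] by (simp add: flat_def)
  qed
  have PP: "P (m q) *v (P q *v h) = h" if "norm q < 1" for q h
    using involution_jacobian[OF open_symmetrized_bidisc J S inv flat_mem[OF that]] by (simp add: P_def flat_eq that)
  have inv_entries: "P q $ 1 $ 1 * P (m q) $ 1 $ 1 = 1" "P q $ 2 $ 2 \<noteq> 0" if q: "norm q < 1" for q
    using PP[OF q, of "vector [1, 0]"] PP[OF q, of "vector [0, 1]"] P12[OF q] P12[OF m1[OF q]]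
    by (auto simp: vec_eq_iff mv forall_2 mult.commute)
  show False
  proof (rule no_flat_symmetry[where m = m and D = "\<lambda>q. (norm (P q $ 1 $ 1))\<^sup>2" and \<kappa> = "\<lambda>q. P q $ 2 $ 2"
        and ?y1.0 = "\<lambda>q \<sigma>. P q $ 1 $ 1" and ?y2.0 = "\<lambda>q \<sigma>. P q $ 1 $ 1" and x = "\<lambda>q \<sigma>. 2 * P q $ 2 $ 1"])
    fix q \<sigma> :: complex assume q: "norm q < 1" and \<sigma>: "norm \<sigma> = 1"
    show "disc_transport q (m q) (P q $ 1 $ 1) (P q $ 1 $ 1) (2 * P q $ 2 $ 1) (P q $ 2 $ 2)"
      unfolding disc_transport_def
    proof (intro allI impI)
      fix s p \<alpha> \<beta>
      assume hs: "s holomorphic_on ball 0 1" and hp: "p holomorphic_on ball 0 1"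
        and mem: "\<forall>t. norm t < 1 \<longrightarrow> (\<exists>z w. norm z < 1 \<and> norm w < 1 \<and> s t = z + w \<and> p t = z * w)"
        and 0: "s 0 = 0" "p 0 = q"
        and D: "(s has_field_derivative 2 * \<alpha>) (at 0)" "(p has_field_derivative \<beta>) (at 0)"
      define d :: "complex \<Rightarrow> complex^2" where "d t = vector [s t, p t]" for t
      have d_mem: "d t \<in> symmetrized_bidisc" if "t \<in> ball 0 1" for t
      proof -
        from that have "norm t < 1" by simp
        then obtain z w where zw: "norm z < 1" "norm w < 1" "s t = z + w" "p t = z * w" using mem by blast
        then show ?thesis using tetra_symmetrization[OF zw(1,2)] by (simp add: mem_symmetrized_bidisc_iff d_def)
      qed
      have d0: "d 0 = flat q" by (simp add: d_def flat_def 0)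
      have "\<forall>j. (\<lambda>t. d t $ j) holomorphic_on ball 0 1"
        unfolding forall_2 d_def vector_2 by (intro conjI hs hp)
      then have hd: "(\<lambda>t. \<gamma> (d t) $ i) holomorphic_on ball 0 1" for i
        by (intro holomorphic_on_component_comp[OF J _ open_ball d_mem]) auto
      have "\<forall>j. ((\<lambda>t. d t $ j) has_field_derivative vector [2 * \<alpha>, \<beta>] $ j) (at 0)"
        unfolding forall_2 d_def vector_2 using D by blast
      then have "((\<lambda>t. \<gamma> (d t) $ i) has_field_derivative (P q *v vector [2 * \<alpha>, \<beta>]) $ i) (at 0)" for i
        using has_field_derivative_component_comp[of \<gamma> "P q" d 0] J[OF flat_mem[OF q]] by (simp add: d0 P_def)
      then have Dd: "((\<lambda>t. \<gamma> (d t) $ i) has_field_derivative \<alpha> * (2 * P q $ i $ 1) + \<beta> * P q $ i $ 2) (at 0)" for i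
        by (simp add: mv algebra_simps)
      have tet: "tetra (\<gamma> (d t) $ 1 / 2) (\<gamma> (d t) $ 1 / 2) (\<gamma> (d t) $ 2)" if "norm t < 1" for t
        using d_mem[of t] that S by (auto simp: mem_symmetrized_bidisc_iff[symmetric])
      have D1: "((\<lambda>t. \<gamma> (d t) $ 1 / 2) has_field_derivative \<alpha> * P q $ 1 $ 1) (at 0)"
        using DERIV_cdivide[OF Dd[of 1], of 2] by (simp add: P12[OF q])
      have hd1: "(\<lambda>t. \<gamma> (d t) $ 1 / 2) holomorphic_on ball 0 1" by (intro holomorphic_intros hd) auto
      have "\<gamma> (d 0) $ 1 = 0" "\<gamma> (d 0) $ 2 = m q"
        unfolding d0 flat_eq[OF q] by (simp_all add: flat_def)
      then show "\<exists>f1 f2 f3. f1 holomorphic_on ball 0 1 \<and> f2 holomorphic_on ball 0 1 \<and> f3 holomorphic_on ball 0 1 \<and>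
        (\<forall>t. norm t < 1 \<longrightarrow> tetra (f1 t) (f2 t) (f3 t)) \<and> f1 0 = 0 \<and> f2 0 = 0 \<and> f3 0 = m q \<and>
        (f1 has_field_derivative \<alpha> * P q $ 1 $ 1) (at 0) \<and> (f2 has_field_derivative \<alpha> * P q $ 1 $ 1) (at 0) \<and>
        (f3 has_field_derivative \<alpha> * (2 * P q $ 2 $ 1) + \<beta> * P q $ 2 $ 2) (at 0)"
        using hd1 hd tet D1 Dd[of 2]
        by (intro exI[of _ "\<lambda>t. \<gamma> (d t) $ 1 / 2"] exI[of _ "\<lambda>t. \<gamma> (d t) $ 2"]) simp
    qed
  next
    fix q :: complex assume q: "norm q < 1"
    show "(norm (P q $ 1 $ 1))\<^sup>2 * (norm (P (m q) $ 1 $ 1))\<^sup>2 = 1"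
      using inv_entries(1)[OF q] by (metis norm_mult norm_one one_power2 power_mult_distrib)
    show "\<exists>\<sigma>. norm (\<sigma>::complex) = 1 \<and> (norm (P q $ 1 $ 1))\<^sup>2 \<le> norm (P q $ 1 $ 1 * P q $ 1 $ 1)"
      by (intro exI[of _ 1]) (simp add: norm_mult power2_eq_square)
  next
    assume "m 0 = 0"
    then have a0: "a = 0" using disc_involution_centre[OF a] by (simp add: m_def)
    then have mneg: "m = uminus" by (simp add: m_def fun_eq_iff Moebius_function_simple)
    have \<kappa>: "P q $ 2 $ 2 = -1" if "norm q < 1" for q
    proof -
      have "(uminus has_field_derivative (-1::complex)) (at q)" by (auto intro!: derivative_eq_intros)
      then show ?thesis using Pm[OF that] DERIV_unique unfolding mneg by blast
    qed
    have P0: "P 0 $ 1 $ 1 = -1"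
      using Jl[of "vector [1, 0]"] by (simp add: P_def a0 vec_eq_iff mv forall_2)
    have "continuous_on (ball 0 1) (\<lambda>t. \<chi> i. flat t $ i)"
      by (intro continuous_on_vec_lambda continuous_at_imp_continuous_on ballI DERIV_isCont[OF dflat])
    then have contflat: "continuous_on (ball 0 1) flat" by simp
    have contJ: "continuous_on symmetrized_bidisc J" by (rule continuous_on_jacobian[OF open_symmetrized_bidisc J])
    have "flat ` ball 0 1 \<subseteq> symmetrized_bidisc" by (rule image_subsetI) (simp add: flat_mem)
    then have "continuous_on (ball 0 1) P"
      unfolding P_def by (rule continuous_on_compose2[OF contJ contflat])
    then have F: "continuous_on (ball 0 1) (\<lambda>q. Re (P q $ 1 $ 1 * P q $ 1 $ 1))" by (intro continuous_intros)
    obtain e where e: "e > 0" "\<And>q. q \<in> ball 0 1 \<Longrightarrow> dist q 0 < e \<Longrightarrow>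
        dist (Re (P q $ 1 $ 1 * P q $ 1 $ 1)) (Re (P 0 $ 1 $ 1 * P 0 $ 1 $ 1)) < 1"
      using F[unfolded continuous_on_iff, rule_format, of 0 1] by auto
    have "Re (P q $ 1 $ 1 * P q $ 1 $ 1) > 0" if "norm q < min e 1" for q
      using e(2)[of q] that by (simp add: P0 dist_real_def abs_less_iff)
    then show "(\<forall>q. norm q < 1 \<longrightarrow> m q = - q \<and> P q $ 2 $ 2 = - 1) \<and>
        (\<exists>e>0. \<forall>q \<sigma>. norm q < e \<longrightarrow> norm (\<sigma>::complex) = 1 \<longrightarrow> Re (P q $ 1 $ 1 * P q $ 1 $ 1) > 0)"
      using \<kappa> mneg e(1) by (intro conjI exI[of _ "min e 1"]) auto
  qed (use m1 mm inv_entries in auto)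
qed

theorem proposition4p1:
  shows "(\<nexists>l. point_of_symmetry symmetrized_bidisc l) \<and> (\<nexists>l. point_of_symmetry tetrablock l)"
  by (metis no_symmetry_at_flat_point_symmetrized_bidisc no_symmetry_at_flat_point_tetrablock
      symmetrized_bidisc_symmetry_at_flat_point tetrablock_symmetry_at_flat_point)

end
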